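(* Let $(R,\mathfrak m)$ be a $d$-dimensional Cohen-Macaulay analytically unramified local ring with positive prime characteristic $p$. Let $I$ be an ideal generated by a system of parameters in $R$. Then $(I^{n+1})^*=(I^2)^*I^{n-1}$ for all $n\ge 1$ if and only if for all $n\ge 0$, $$\ell\left(\frac{R}{(I^{n+1})^*}\right)=e_0^*(I)\binom{n+d}{d}-e_1^*(I)\binom{n+d-1}{d-1}+e_2^*(I)\binom{n+d-2}{d-2},$$ where $$e_0^*(I)=e_0(I)=\ell\left(\frac{R}{I}\right),\qquad e_1^*(I)=\ell\left(\frac{I^*}{I}\right)+\ell\left(\frac{(I^2)^*}{II^*}\right),\qquad e_2^*(I)=\ell\left(\frac{(I^2)^*}{II^*}\right),$$ and $e_i^*(I)=0$ for all $3\le i\le d$.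
   Context: $\ell$ denotes length. $R$ is analytically unramified if its $\mathfrak m$-adic completion is reduced. $J^*$ denotes the tight closure of an ideal $J$: $x\in J^*$ iff there is $c\in R$, not in any minimal prime of $R$, with $cx^q\in J^{[q]}$ for all sufficiently large $q=p^e$, where $J^{[q]}$ is generated by the $q$-th powers of elements of $J$. For an $\mathfrak m$-primary ideal $I$, $\ell(R/(I^n)^* )$ agrees for all large $n$ with a polynomial $$P_I^*(n)=e_0^*(I)\binom{n+d-1}{d}-e_1^*(I)\binom{n+d-2}{d-1}+\cdots+(-1)^d e_d^*(I)$$ (the tight Hilbert polynomial of $I$), whose coefficients $e_i^*(I)$ are integers; $e_0(I)$ is the multiplicity of $I$. *)

theory Defs
  imports
    "HOL-Computational_Algebra.Primes"
    "HOL-Library.Extended_Nat"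
    "HOL-Algebra.Algebra"
begin

section \<open>Noetherian local rings\<close>

definition noetherian_local_ring :: "('a, 'b) ring_scheme \<Rightarrow> 'a set \<Rightarrow> bool" where
  "noetherian_local_ring R m \<longleftrightarrow>
     cring R \<and> noetherian_ring R \<and> maximalideal m R \<and> (\<forall>M. maximalideal M R \<longrightarrow> M = m)"

abbreviation ideal_pow :: "('a, 'b) ring_scheme \<Rightarrow> 'a set \<Rightarrow> nat \<Rightarrow> 'a set" where
  "ideal_pow R I n \<equiv> I [^]\<^bsub>ideals_set R\<^esub> n"

definition krull_dim :: "('a, 'b) ring_scheme \<Rightarrow> enat" where
  "krull_dim R =
     Sup {enat n | n. \<exists>P :: nat \<Rightarrow> 'a set.
            (\<forall>i\<le>n. primeideal (P i) R) \<and> (\<forall>i<n. P i \<subset> P (Suc i))}"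

definition radical_ideal :: "('a, 'b) ring_scheme \<Rightarrow> 'a set \<Rightarrow> 'a set" where
  "radical_ideal R I = {a \<in> carrier R. \<exists>k::nat. a [^]\<^bsub>R\<^esub> k \<in> I}"

text \<open>An ideal whose radical is the maximal ideal \<open>m\<close> is automatically \<open>m\<close>-primary.\<close>

definition system_of_parameters :: "('a, 'b) ring_scheme \<Rightarrow> 'a set \<Rightarrow> 'a list \<Rightarrow> bool" where
  "system_of_parameters R m xs \<longleftrightarrow>
     set xs \<subseteq> m \<and> krull_dim R = enat (length xs) \<and> radical_ideal R (Idl\<^bsub>R\<^esub> (set xs)) = m"

text \<open>The last conjunct says that \<open>xs ! i\<close> is a nonzerodivisor on
  \<open>R / (xs ! 0, \<dots>, xs ! (i - 1))\<close>.\<close>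

definition regular_sequence :: "('a, 'b) ring_scheme \<Rightarrow> 'a list \<Rightarrow> bool" where
  "regular_sequence R xs \<longleftrightarrow>
     set xs \<subseteq> carrier R \<and> Idl\<^bsub>R\<^esub> (set xs) \<noteq> carrier R \<and>
     (\<forall>i<length xs. \<forall>a\<in>carrier R.
        xs ! i \<otimes>\<^bsub>R\<^esub> a \<in> Idl\<^bsub>R\<^esub> (set (take i xs)) \<longrightarrow> a \<in> Idl\<^bsub>R\<^esub> (set (take i xs)))"

definition ring_depth :: "('a, 'b) ring_scheme \<Rightarrow> 'a set \<Rightarrow> enat" where
  "ring_depth R m = Sup {enat (length xs) | xs. set xs \<subseteq> m \<and> regular_sequence R xs}"

definition cohen_macaulay :: "('a, 'b) ring_scheme \<Rightarrow> 'a set \<Rightarrow> bool" where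
  "cohen_macaulay R m \<longleftrightarrow> ring_depth R m = krull_dim R"

text \<open>The \<open>m\<close>-adic completion is the inverse limit of the rings \<open>R / m\<^sup>n\<close>.  The transition map
  \<open>R / m\<^sup>n\<^sup>+\<^sup>1 \<rightarrow> R / m\<^sup>n\<close> sends a coset to the unique coset of \<open>m\<^sup>n\<close> containing it, so that a family
  \<open>x\<close> is coherent iff \<open>x (n + 1) \<subseteq> x n\<close> for all \<open>n\<close>.\<close>

definition adic_completion :: "('a, 'b) ring_scheme \<Rightarrow> 'a set \<Rightarrow> (nat \<Rightarrow> 'a set) ring" where
  "adic_completion R m =
     (let Q = (\<lambda>n. R Quot ideal_pow R m n) in
      \<lparr>carrier = {x. (\<forall>n. x n \<in> carrier (Q n)) \<and> (\<forall>n. x (Suc n) \<subseteq> x n)},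
       monoid.mult = (\<lambda>x y n. x n \<otimes>\<^bsub>Q n\<^esub> y n),
       one = (\<lambda>n. \<one>\<^bsub>Q n\<^esub>),
       ring.zero = (\<lambda>n. \<zero>\<^bsub>Q n\<^esub>),
       add = (\<lambda>x y n. x n \<oplus>\<^bsub>Q n\<^esub> y n)\<rparr>)"

definition reduced_ring :: "('a, 'b) ring_scheme \<Rightarrow> bool" where
  "reduced_ring R \<longleftrightarrow> (\<forall>x\<in>carrier R. \<forall>k::nat. x [^]\<^bsub>R\<^esub> k = \<zero>\<^bsub>R\<^esub> \<longrightarrow> x = \<zero>\<^bsub>R\<^esub>)"

definition analytically_unramified :: "('a, 'b) ring_scheme \<Rightarrow> 'a set \<Rightarrow> bool" where
  "analytically_unramified R m \<longleftrightarrow> reduced_ring (adic_completion R m)"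


section \<open>Tight closure\<close>

definition minimal_prime :: "('a, 'b) ring_scheme \<Rightarrow> 'a set \<Rightarrow> bool" where
  "minimal_prime R P \<longleftrightarrow>
     primeideal P R \<and> (\<forall>Q. primeideal Q R \<and> Q \<subseteq> P \<longrightarrow> Q = P)"

definition frobenius_power :: "('a, 'b) ring_scheme \<Rightarrow> nat \<Rightarrow> 'a set \<Rightarrow> 'a set" where
  "frobenius_power R q J = Idl\<^bsub>R\<^esub> ((\<lambda>a. a [^]\<^bsub>R\<^esub> q) ` J)"

definition tight_closure :: "('a, 'b) ring_scheme \<Rightarrow> nat \<Rightarrow> 'a set \<Rightarrow> 'a set" where
  "tight_closure R p J =
     {x \<in> carrier R. \<exists>c\<in>carrier R. (\<forall>P. minimal_prime R P \<longrightarrow> c \<notin> P) \<and>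
        (\<forall>\<^sub>F e in sequentially. c \<otimes>\<^bsub>R\<^esub> x [^]\<^bsub>R\<^esub> (p ^ e) \<in> frobenius_power R (p ^ e) J)}"


section \<open>Length\<close>

definition module_length :: "('a, 'b) ring_scheme \<Rightarrow> ('a, 'c, 'd) module_scheme \<Rightarrow> enat" where
  "module_length R M =
     Sup {enat n | n. \<exists>N :: nat \<Rightarrow> 'c set.
            (\<forall>i\<le>n. submodule (N i) R M) \<and> (\<forall>i<n. N i \<subset> N (Suc i))}"

text \<open>The \<open>R\<close>-module \<open>J / K\<close> for ideals \<open>K \<subseteq> J\<close>.  The fields \<open>mult\<close> and \<open>one\<close> play no role for the
  module structure; scalar multiplication is \<open>a \<odot> (K + x) = (K + a) \<cdot> (K + x) = K + a x\<close>.\<close>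

definition quotient_module ::
    "('a, 'b) ring_scheme \<Rightarrow> 'a set \<Rightarrow> 'a set \<Rightarrow> ('a, 'a set) module" where
  "quotient_module R J K =
     \<lparr>carrier = (\<lambda>x. K +>\<^bsub>R\<^esub> x) ` J, monoid.mult = rcoset_mult R K, one = K +>\<^bsub>R\<^esub> \<one>\<^bsub>R\<^esub>,
      ring.zero = K, add = set_add R, smult = (\<lambda>a Y. rcoset_mult R K (K +>\<^bsub>R\<^esub> a) Y)\<rparr>"

text \<open>\<open>len R J K\<close> is \<open>\<ell>(J / K)\<close> as a natural number, meaningful when this length is finite; this is
  the case whenever \<open>K\<close> contains a power of the maximal ideal.\<close>

definition len :: "('a, 'b) ring_scheme \<Rightarrow> 'a set \<Rightarrow> 'a set \<Rightarrow> nat" where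
  "len R J K = the_enat (module_length R (quotient_module R J K))"


section \<open>Hilbert polynomials\<close>

text \<open>\<open>e 0, \<dots>, e d\<close> are the coefficients, in the signed binomial basis, of a polynomial that
  agrees with \<open>H\<close> at all large arguments.
  Values \<open>e i\<close> with \<open>i > d\<close> are irrelevant.\<close>

definition hilbert_coeffs :: "nat \<Rightarrow> (nat \<Rightarrow> nat) \<Rightarrow> (nat \<Rightarrow> int) \<Rightarrow> bool" where
  "hilbert_coeffs d H e \<longleftrightarrow>
     (\<forall>\<^sub>F n in sequentially.
        int (H n) = (\<Sum>i\<le>d. (-1) ^ i * e i * int ((n + d - 1 - i) choose (d - i))))"

lemma binomial_combination_zero:
  fixes c :: "nat \<Rightarrow> int"
  assumes "\<forall>\<^sub>F n in sequentially. (\<Sum>i\<le>d. c i * int ((n + d - 1 - i) choose (d - i))) = 0"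
    and "i \<le> d"
  shows "c i = 0"
  using assms
proof (induction d arbitrary: i)
  case 0
  then show ?case by simp
next
  case (Suc d)
  let ?f = "\<lambda>d n. \<Sum>i\<le>d. c i * int ((n + d - 1 - i) choose (d - i))"
  from Suc.prems(1) obtain N where N: "?f (Suc d) n = 0" if "n \<ge> N" for n
    by (auto simp: eventually_sequentially)
  have diff: "?f (Suc d) (Suc n) - ?f (Suc d) n = ?f d (Suc n)" for n
  proof -
    have *: "int ((Suc n + Suc d - 1 - i) choose (Suc d - i))
             = int ((n + Suc d - 1 - i) choose (Suc d - i))
               + int ((Suc n + d - 1 - i) choose (d - i))" if "i \<le> d" for i
    proof -
      have "Suc n + Suc d - 1 - i = Suc (n + d - i)" "Suc d - i = Suc (d - i)"
        using that by auto
      then show ?thesis by simp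
    qed
    have "?f (Suc d) (Suc n) - ?f (Suc d) n
        = (\<Sum>i\<le>d. c i * int ((Suc n + Suc d - 1 - i) choose (Suc d - i)))
          - (\<Sum>i\<le>d. c i * int ((n + Suc d - 1 - i) choose (Suc d - i)))"
      by simp
    also have "\<dots> = ?f d (Suc n)"
      unfolding sum_subtractf [symmetric]
      by (intro sum.cong refl) (simp only: * atMost_iff of_nat_add distrib_left add_diff_cancel_left')
    finally show ?thesis .
  qed
  have "?f d n = 0" if "n \<ge> Suc N" for n
    using that N[of n] N[of "n - 1"] diff[of "n - 1"] by simp
  then have ev: "\<forall>\<^sub>F n in sequentially. ?f d n = 0"
    unfolding eventually_sequentially by blast
  have low: "c j = 0" if "j \<le> d" for j
    using Suc.IH[OF ev that] .
  then have "?f (Suc d) N = c (Suc d)" by simp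
  then have "c (Suc d) = 0" using N[of N] by simp
  with low Suc.prems(2) show ?case by (cases "i = Suc d") auto
qed

lemma hilbert_coeffs_unique:
  assumes "hilbert_coeffs d H e" "hilbert_coeffs d H e'" "i \<le> d"
  shows "e i = e' i"
proof -
  have "\<forall>\<^sub>F n in sequentially.
      (\<Sum>i\<le>d. ((-1) ^ i * (e i - e' i)) * int ((n + d - 1 - i) choose (d - i))) = 0"
    using eventually_conj[OF assms(1)[unfolded hilbert_coeffs_def] assms(2)[unfolded hilbert_coeffs_def]]
    by (rule eventually_mono) (simp add: algebra_simps sum_subtractf)
  from binomial_combination_zero[OF this assms(3)] show ?thesis by simp
qed

text \<open>The multiplicity \<open>e\<^sub>0(I)\<close> of an \<open>m\<close>-primary ideal \<open>I\<close> of a \<open>d\<close>-dimensional ring: the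
  normalised leading coefficient of its Hilbert-Samuel polynomial.\<close>

definition multiplicity_ideal :: "('a, 'b) ring_scheme \<Rightarrow> nat \<Rightarrow> 'a set \<Rightarrow> int" where
  "multiplicity_ideal R d I =
     (THE c. \<exists>e. hilbert_coeffs d (\<lambda>n. len R (carrier R) (ideal_pow R I n)) e \<and> e 0 = c)"

text \<open>\<open>e i\<close> is the coefficient \<open>e\<^sub>i\<^sup>*(I)\<close> of the tight Hilbert polynomial, for all \<open>i \<le> d\<close>.  By
  \<open>hilbert_coeffs_unique\<close> these values are determined by \<open>I\<close>.\<close>

definition tight_hilbert_coeffs ::
    "('a, 'b) ring_scheme \<Rightarrow> nat \<Rightarrow> nat \<Rightarrow> 'a set \<Rightarrow> (nat \<Rightarrow> int) \<Rightarrow> bool" where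
  "tight_hilbert_coeffs R p d I e \<longleftrightarrow>
     hilbert_coeffs d (\<lambda>n. len R (carrier R) (tight_closure R p (ideal_pow R I n))) e"

text \<open>The binomial coefficient \<open>(n + k over k)\<close>, that is, the coefficient of \<open>z\<^sup>n\<close> in the power series
  of \<open>(1 - z)\<close> to the power \<open>- (k + 1)\<close>.  The latter description fixes the meaning for negative \<open>k\<close>;
  for \<open>k = -1\<close> the value is \<open>1\<close> if \<open>n = 0\<close> and \<open>0\<close> otherwise.\<close>

definition shifted_binomial :: "nat \<Rightarrow> int \<Rightarrow> int" where
  "shifted_binomial n k =
     (if k \<ge> 0 then int ((n + nat k) choose nat k)
      else (-1) ^ n * int (nat (- k - 1) choose n))"

end

theory Submission
  imports Defs
begin

text \<open>Write \<open>T\<^sub>n = (I\<^sup>n)\<^sup>*\<close> and \<open>L = \<ell>(T\<^sub>2 / I I\<^sup>*)\<close>.  By depth sensitivity of the Koszul complex, every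
  system of parameters \<open>z\<close> satisfies \<open>(z\<^sub>i\<^sup>\<alpha>\<^sup>i\<^sup>+\<^sup>1) : z\<^sup>\<alpha> = (z)\<close>.  Hence the monomials of degree \<open>n\<close> are
  independent modulo \<open>I\<^sup>n\<^sup>+\<^sup>1\<close>, and \<open>\<ell>(K I\<^sup>n / I\<^sup>n\<^sup>+\<^sup>1) = r\<^sub>n \<ell>(K / I)\<close> for every ideal \<open>K \<supseteq> I\<close>, where \<open>r\<^sub>n\<close> is the
  number of these monomials; applied to \<open>z\<^sup>q\<close> it gives \<open>T\<^sub>n\<^sub>+\<^sub>1 \<inter> I\<^sup>n = I\<^sup>* I\<^sup>n\<close>.  It follows that
  \<open>\<ell>(R / T\<^sub>n\<^sub>+\<^sub>1) = \<ell>(R / I) (r\<^sub>0 + \<dots> + r\<^sub>n) - \<ell>(I\<^sup>* / I) r\<^sub>n - \<ell>(T\<^sub>n\<^sub>+\<^sub>1 / I\<^sup>* I\<^sup>n)\<close>.  The last term is the length of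
  \<open>(T\<^sub>n\<^sub>+\<^sub>1 + I\<^sup>n) / I\<^sup>n\<close>, which contains \<open>(T\<^sub>2 I\<^sup>n\<^sup>-\<^sup>1 + I\<^sup>n) / I\<^sup>n\<close>, of length \<open>L r\<^sub>n\<^sub>-\<^sub>1\<close>.  So \<open>T\<^sub>n\<^sub>+\<^sub>1 = T\<^sub>2 I\<^sup>n\<^sup>-\<^sup>1\<close>
  iff the two lengths agree, which is the claimed formula at \<open>n\<close>.\<close>

section \<open>Ideals\<close>

context cring
begin

lemma ideal_add: "\<lbrakk>ideal J R; x \<in> J; y \<in> J\<rbrakk> \<Longrightarrow> x \<oplus> y \<in> J"
  by (simp add: additive_subgroup.a_closed ideal.axioms(1))

lemma ideal_zero: "ideal J R \<Longrightarrow> \<zero> \<in> J"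
  by (simp add: additive_subgroup.zero_closed ideal.axioms(1))

lemma ideal_mult: "\<lbrakk>ideal J R; x \<in> J; a \<in> carrier R\<rbrakk> \<Longrightarrow> a \<otimes> x \<in> J"
  by (simp add: ideal.I_l_closed)

lemma ideal_neg:
  assumes "ideal J R" "x \<in> J"
  shows "\<ominus> x \<in> J"
proof -
  have "x \<in> carrier R" using ideal.Icarr[OF assms] .
  then have "\<ominus> x = (\<ominus> \<one>) \<otimes> x" by (simp add: l_minus)
  then show ?thesis using ideal_mult[OF assms, of "\<ominus> \<one>"] by simp
qed

lemma ideal_diff:
  assumes "ideal J R" "x \<in> J" "y \<in> J"
  shows "x \<ominus> y \<in> J"
  using ideal_add[OF assms(1,2) ideal_neg[OF assms(1,3)]] unfolding a_minus_def .

lemma ideal_subset: "ideal J R \<Longrightarrow> J \<subseteq> carrier R"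
  by (rule subsetI) (rule ideal.Icarr)

lemma ideal_add_cancel:
  assumes "ideal J R" "x \<oplus> y \<in> J" "y \<in> J" "x \<in> carrier R"
  shows "x \<in> J"
proof -
  have "y \<in> carrier R" using ideal.Icarr[OF assms(1,3)] .
  then have "x = (x \<oplus> y) \<ominus> y" using assms(4) by algebra
  then show ?thesis using ideal_diff[OF assms(1,2,3)] by simp
qed

lemma idealI_cring:
  assumes "J \<subseteq> carrier R" "\<zero> \<in> J" "\<And>x y. \<lbrakk>x \<in> J; y \<in> J\<rbrakk> \<Longrightarrow> x \<oplus> y \<in> J"
    and mult: "\<And>a x. \<lbrakk>a \<in> carrier R; x \<in> J\<rbrakk> \<Longrightarrow> a \<otimes> x \<in> J"
  shows "ideal J R"
proof (rule idealI)
  show "subgroup J (add_monoid R)"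
  proof (rule add.subgroupI)
    fix a assume a: "a \<in> J"
    then have "\<ominus> a = (\<ominus> \<one>) \<otimes> a" using assms(1) by (simp add: l_minus subset_iff)
    then show "\<ominus> a \<in> J" using mult[OF _ a] by simp
  qed (use assms in auto)
next
  fix a x assume "a \<in> J" "x \<in> carrier R"
  then show "x \<otimes> a \<in> J" "a \<otimes> x \<in> J" using mult[of x a] m_comm[of a x] assms(1) by auto
qed (rule ring_axioms)

lemma mem_Idl_insert:
  assumes "z \<in> carrier R" "A \<subseteq> carrier R"
  shows "x \<in> Idl (insert z A) \<longleftrightarrow> (\<exists>b\<in>carrier R. \<exists>y\<in>Idl A. x = b \<otimes> z \<oplus> y)"
proof
  have A: "ideal (Idl A) R" and iA: "ideal (Idl (insert z A)) R"
    using assms by (auto intro: genideal_ideal)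
  let ?S = "set_add R (PIdl z) (Idl A)"
  have S: "ideal ?S R"
    by (rule add_ideals) (auto intro: cgenideal_ideal A assms)
  have "z \<in> ?S"
    using cgenideal_self[OF assms(1)] ideal_zero[OF A] assms(1) r_zero unfolding set_add_def'
    by fastforce
  moreover have "A \<subseteq> ?S"
  proof
    fix a assume a: "a \<in> A"
    then have "\<zero> \<oplus> a \<in> ?S"
      using genideal_self[OF assms(2)] ideal_zero[OF cgenideal_ideal[OF assms(1)]]
      unfolding set_add_def' by blast
    then show "a \<in> ?S" using a assms by (simp add: subset_iff)
  qed
  ultimately have sub: "Idl (insert z A) \<subseteq> ?S"
    by (intro genideal_minimal S) auto
  {
    assume "x \<in> Idl (insert z A)"
    with sub show "\<exists>b\<in>carrier R. \<exists>y\<in>Idl A. x = b \<otimes> z \<oplus> y"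
      unfolding set_add_def' cgenideal_def by blast
  next
    assume "\<exists>b\<in>carrier R. \<exists>y\<in>Idl A. x = b \<otimes> z \<oplus> y"
    then obtain b y where b: "b \<in> carrier R" "y \<in> Idl A" "x = b \<otimes> z \<oplus> y" by blast
    have "y \<in> Idl (insert z A)"
      using b(2) subset_Idl_subset[of "insert z A" A] assms by auto
    moreover have "z \<in> Idl (insert z A)"
      using genideal_self[of "insert z A"] assms by auto
    ultimately show "x \<in> Idl (insert z A)"
      using b iA by (auto intro: ideal_mult ideal_add)
  }
qed

lemma Idl_empty: "Idl {} = {\<zero>}"
  using genideal_minimal[OF zeroideal, of "{}"] ideal_zero[OF genideal_ideal[of "{}"]] by auto

end

section \<open>The Koszul complex\<close>

text \<open>A list of Booleans of length \<open>length zs\<close> stands for a subset of the indices of \<open>zs\<close>, hence for a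
  basis element of the exterior algebra, of degree the number of entries \<open>True\<close>; values of a function
  on lists of another length are junk.  For \<open>y = dot_list R bs zs\<close> the map \<open>khom R bs\<close> is a null
  homotopy of multiplication by \<open>y\<close>.\<close>

primrec kdiff :: "('a, 'b) ring_scheme \<Rightarrow> 'a list \<Rightarrow> (bool list \<Rightarrow> 'a) \<Rightarrow> bool list \<Rightarrow> 'a" where
  "kdiff R [] f S = \<zero>\<^bsub>R\<^esub>"
| "kdiff R (z # zs) f S =
    (if hd S then \<ominus>\<^bsub>R\<^esub> kdiff R zs (\<lambda>T. f (True # T)) (tl S)
     else kdiff R zs (\<lambda>T. f (False # T)) (tl S) \<oplus>\<^bsub>R\<^esub> z \<otimes>\<^bsub>R\<^esub> f (True # tl S))"

primrec khom :: "('a, 'b) ring_scheme \<Rightarrow> 'a list \<Rightarrow> (bool list \<Rightarrow> 'a) \<Rightarrow> bool list \<Rightarrow> 'a" where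
  "khom R [] f S = \<zero>\<^bsub>R\<^esub>"
| "khom R (b # bs) f S =
    (if hd S then b \<otimes>\<^bsub>R\<^esub> f (False # tl S) \<ominus>\<^bsub>R\<^esub> khom R bs (\<lambda>T. f (True # T)) (tl S)
     else khom R bs (\<lambda>T. f (False # T)) (tl S))"

fun dot_list :: "('a, 'b) ring_scheme \<Rightarrow> 'a list \<Rightarrow> 'a list \<Rightarrow> 'a" where
  "dot_list R (b # bs) (z # zs) = b \<otimes>\<^bsub>R\<^esub> z \<oplus>\<^bsub>R\<^esub> dot_list R bs zs"
| "dot_list R _ _ = \<zero>\<^bsub>R\<^esub>"

abbreviation trues :: "bool list \<Rightarrow> nat" where
  "trues S \<equiv> length (filter id S)"

definition vanishes_below :: "('a, 'b) ring_scheme \<Rightarrow> nat \<Rightarrow> nat \<Rightarrow> (bool list \<Rightarrow> 'a) \<Rightarrow> bool" where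
  "vanishes_below R n k f \<longleftrightarrow> (\<forall>S. length S = n \<longrightarrow> trues S < k \<longrightarrow> f S = \<zero>\<^bsub>R\<^esub>)"

context cring
begin

lemma kdiff_closed [simp]:
  "\<lbrakk>set zs \<subseteq> carrier R; \<And>T. f T \<in> carrier R\<rbrakk> \<Longrightarrow> kdiff R zs f S \<in> carrier R"
  by (induction zs arbitrary: f S) auto

lemma khom_closed [simp]:
  "\<lbrakk>set bs \<subseteq> carrier R; \<And>T. f T \<in> carrier R\<rbrakk> \<Longrightarrow> khom R bs f S \<in> carrier R"
  by (induction bs arbitrary: f S) auto

lemma dot_list_closed [simp]:
  "\<lbrakk>set bs \<subseteq> carrier R; set zs \<subseteq> carrier R\<rbrakk> \<Longrightarrow> dot_list R bs zs \<in> carrier R"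
  by (induction bs zs rule: list_induct2') auto

lemma kdiff_add:
  assumes "set zs \<subseteq> carrier R" "\<And>T. f T \<in> carrier R" "\<And>T. g T \<in> carrier R"
  shows "kdiff R zs (\<lambda>T. f T \<oplus> g T) S = kdiff R zs f S \<oplus> kdiff R zs g S"
  using assms
proof (induction zs arbitrary: f g S)
  case (Cons z zs)
  have c: "kdiff R zs (\<lambda>T. f (b # T)) U \<in> carrier R" "kdiff R zs (\<lambda>T. g (b # T)) U \<in> carrier R" for b U
    using Cons.prems by auto
  have fg: "f T \<in> carrier R" "g T \<in> carrier R" "z \<in> carrier R" for T using Cons.prems by auto
  show ?case
    using Cons.prems c fg
    by (simp add: Cons.IH minus_add r_distr a_ac)
qed simp

lemma kdiff_smult:
  assumes "set zs \<subseteq> carrier R" "\<And>T. f T \<in> carrier R" "a \<in> carrier R"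
  shows "kdiff R zs (\<lambda>T. a \<otimes> f T) S = a \<otimes> kdiff R zs f S"
  using assms
  by (induction zs arbitrary: f S) (auto simp: r_minus r_distr m_lcomm)

lemma kdiff_minus:
  assumes "set zs \<subseteq> carrier R" "\<And>T. f T \<in> carrier R"
  shows "kdiff R zs (\<lambda>T. \<ominus> f T) S = \<ominus> kdiff R zs f S"
  using assms
  by (induction zs arbitrary: f S) (auto simp: minus_add r_minus a_ac)

lemma khom_add:
  assumes "set zs \<subseteq> carrier R" "\<And>T. f T \<in> carrier R" "\<And>T. g T \<in> carrier R"
  shows "khom R zs (\<lambda>T. f T \<oplus> g T) S = khom R zs f S \<oplus> khom R zs g S"
  using assms
proof (induction zs arbitrary: f g S)
  case (Cons z zs)
  have c: "khom R zs (\<lambda>T. f (b # T)) U \<in> carrier R" "khom R zs (\<lambda>T. g (b # T)) U \<in> carrier R" for b U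
    using Cons.prems by auto
  have fg: "f T \<in> carrier R" "g T \<in> carrier R" "z \<in> carrier R" for T using Cons.prems by auto
  show ?case
    using Cons.prems c fg
    by (simp add: Cons.IH minus_add r_distr a_ac a_minus_def)
qed simp

lemma khom_smult:
  assumes "set zs \<subseteq> carrier R" "\<And>T. f T \<in> carrier R" "a \<in> carrier R"
  shows "khom R zs (\<lambda>T. a \<otimes> f T) S = a \<otimes> khom R zs f S"
  using assms
  by (induction zs arbitrary: f S) (auto simp: r_minus r_distr m_lcomm a_minus_def)

lemma khom_minus:
  assumes "set zs \<subseteq> carrier R" "\<And>T. f T \<in> carrier R"
  shows "khom R zs (\<lambda>T. \<ominus> f T) S = \<ominus> khom R zs f S"
  using assms
  by (induction zs arbitrary: f S) (auto simp: minus_add r_minus a_ac a_minus_def)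

lemma kdiff_mem_ideal:
  assumes "set zs \<subseteq> carrier R" "ideal Y R" "\<And>T. length T = length zs \<Longrightarrow> f T \<in> Y"
    and "length S = length zs"
  shows "kdiff R zs f S \<in> Y"
  using assms
proof (induction zs arbitrary: f S)
  case (Cons z zs)
  then obtain b T where S: "S = b # T" "length T = length zs" by (cases S) auto
  have "kdiff R zs (\<lambda>T. f (c # T)) T \<in> Y" for c
    using Cons.prems S by (intro Cons.IH) auto
  then show ?case using S Cons.prems by (auto intro!: ideal_mult ideal_add ideal_neg)
qed (auto simp: ideal_zero)

lemma khom_mem_ideal:
  assumes "set zs \<subseteq> carrier R" "ideal Y R" "\<And>T. length T = length zs \<Longrightarrow> f T \<in> Y"
    and "length S = length zs"
  shows "khom R zs f S \<in> Y"
  using assms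
proof (induction zs arbitrary: f S)
  case (Cons z zs)
  then obtain b T where S: "S = b # T" "length T = length zs" by (cases S) auto
  have "khom R zs (\<lambda>T. f (c # T)) T \<in> Y" for c
    using Cons.prems S by (intro Cons.IH) auto
  then show ?case using S Cons.prems by (auto intro!: ideal_mult ideal_diff)
qed (auto simp: ideal_zero)

lemma kdiff_mem_Idl:
  assumes "set zs \<subseteq> carrier R" "\<And>T. f T \<in> carrier R"
  shows "kdiff R zs f S \<in> Idl (set zs)"
  using assms
proof (induction zs arbitrary: f S)
  case Nil
  then show ?case by (simp add: Idl_empty)
next
  case (Cons z zs)
  have I: "ideal (Idl (set (z # zs))) R" using Cons.prems by (intro genideal_ideal) auto
  have "kdiff R zs (\<lambda>T. f (c # T)) U \<in> Idl (set (z # zs))" for c U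
    using Cons.IH[of "\<lambda>T. f (c # T)" U] Cons.prems
      subset_Idl_subset[of "set (z # zs)" "set zs"] by auto
  moreover have "f T \<otimes> z \<in> Idl (set (z # zs))" for T
    using Cons.prems genideal_self[of "set (z # zs)"] by (intro ideal_mult[OF I]) auto
  then have "z \<otimes> f T \<in> Idl (set (z # zs))" for T
    using m_comm[of z "f T"] Cons.prems by simp
  ultimately show ?case using I by (auto intro: ideal_add ideal_neg)
qed

lemma kdiff_kdiff:
  assumes "set zs \<subseteq> carrier R" "\<And>T. f T \<in> carrier R"
  shows "kdiff R zs (kdiff R zs f) S = \<zero>"
  using assms
proof (induction zs arbitrary: f S)
  case (Cons z zs)
  have z: "z \<in> carrier R" "set zs \<subseteq> carrier R" and f: "\<And>T. f T \<in> carrier R" using Cons.prems by auto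
  let ?f = "\<lambda>b T. f (b # T)"
  have c: "kdiff R zs (?f b) U \<in> carrier R" for b U using z f by auto
  have 1: "kdiff R zs (kdiff R zs (?f b)) U = \<zero>" for b U using Cons.IH z f by auto
  have "kdiff R zs (\<lambda>T. \<ominus> kdiff R zs (?f True) T) U = \<zero>" for U
    using z c by (simp add: kdiff_minus 1)
  moreover have "kdiff R zs (\<lambda>T. kdiff R zs (?f False) T \<oplus> z \<otimes> f (True # T)) U
      \<oplus> z \<otimes> (\<ominus> kdiff R zs (?f True) U) = \<zero>" for U
    using z c f by (simp add: kdiff_add kdiff_smult 1 r_minus r_neg)
  ultimately show ?case by simp
qed simp

lemma kdiff_khom:
  assumes "set zs \<subseteq> carrier R" "set bs \<subseteq> carrier R" "\<And>T. f T \<in> carrier R"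
    and "length bs = length zs" "length S = length zs"
  shows "kdiff R zs (khom R bs f) S \<oplus> khom R bs (kdiff R zs f) S = dot_list R bs zs \<otimes> f S"
  using assms
proof (induction zs arbitrary: bs f S)
  case (Cons z zs bs0)
  then obtain b bs where bs: "bs0 = b # bs" "length bs = length zs" by (cases bs0) auto
  from Cons.prems obtain s T where S: "S = s # T" "length T = length zs" by (cases S) auto
  have z: "z \<in> carrier R" "set zs \<subseteq> carrier R" and b: "b \<in> carrier R" "set bs \<subseteq> carrier R"
    and f: "\<And>T. f T \<in> carrier R" using Cons.prems bs by auto
  let ?f = "\<lambda>b T. f (b # T)"
  have c: "kdiff R zs (?f b) U \<in> carrier R" "khom R bs (?f b) U \<in> carrier R"
    "khom R bs (kdiff R zs (?f b)) U \<in> carrier R" "kdiff R zs (khom R bs (?f b)) U \<in> carrier R" for b U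
    using z b f by auto
  have d: "dot_list R bs zs \<in> carrier R" using z b by simp
  have IH: "kdiff R zs (khom R bs (?f s)) T \<oplus> khom R bs (kdiff R zs (?f s)) T = dot_list R bs zs \<otimes> f (s # T)" for s
    using Cons.IH[of bs "?f s" T] z b f bs S by simp
  have eq1: "\<ominus> (b \<otimes> A \<ominus> B) \<oplus> (b \<otimes> (A \<oplus> z \<otimes> v) \<ominus> \<ominus> C) = (B \<oplus> C) \<oplus> b \<otimes> z \<otimes> v"
    and eq2: "(B \<oplus> z \<otimes> (b \<otimes> v \<ominus> A)) \<oplus> (C \<oplus> z \<otimes> A) = (B \<oplus> C) \<oplus> b \<otimes> z \<otimes> v"
    if "A \<in> carrier R" "B \<in> carrier R" "C \<in> carrier R" "v \<in> carrier R" for A B C v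
    using that z(1) b(1) by algebra+
  show ?case
  proof (cases s)
    case True
    let ?A = "kdiff R zs (?f False) T" and ?B = "kdiff R zs (khom R bs (?f True)) T"
      and ?C = "khom R bs (kdiff R zs (?f True)) T"
    have "kdiff R zs (\<lambda>T. b \<otimes> f (False # T) \<ominus> khom R bs (?f True) T) T = b \<otimes> ?A \<ominus> ?B"
      using z b c f by (simp add: a_minus_def kdiff_add kdiff_minus kdiff_smult)
    moreover have "khom R bs (\<lambda>T. \<ominus> kdiff R zs (?f True) T) T = \<ominus> ?C"
      using z b c f by (simp add: khom_minus)
    ultimately have "kdiff R (z # zs) (khom R bs0 f) S \<oplus> khom R bs0 (kdiff R (z # zs) f) S
       = \<ominus> (b \<otimes> ?A \<ominus> ?B) \<oplus> (b \<otimes> (?A \<oplus> z \<otimes> f (True # T)) \<ominus> \<ominus> ?C)"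
      using S bs True by simp
    also have "\<dots> = (?B \<oplus> ?C) \<oplus> b \<otimes> z \<otimes> f (True # T)"
      by (rule eq1) (rule c f)+
    also have "\<dots> = dot_list R bs0 (z # zs) \<otimes> f S"
      unfolding IH using S bs True z b d f[of "True # T"] by (simp add: l_distr a_comm)
    finally show ?thesis .
  next
    case False
    let ?A = "khom R bs (?f True) T" and ?B = "kdiff R zs (khom R bs (?f False)) T"
      and ?C = "khom R bs (kdiff R zs (?f False)) T"
    have "khom R bs (\<lambda>T. kdiff R zs (?f False) T \<oplus> z \<otimes> f (True # T)) T = ?C \<oplus> z \<otimes> ?A"
      using z b c f by (simp add: khom_add khom_smult)
    then have "kdiff R (z # zs) (khom R bs0 f) S \<oplus> khom R bs0 (kdiff R (z # zs) f) S
       = (?B \<oplus> z \<otimes> (b \<otimes> f (False # T) \<ominus> ?A)) \<oplus> (?C \<oplus> z \<otimes> ?A)"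
      using S bs False by simp
    also have "\<dots> = (?B \<oplus> ?C) \<oplus> b \<otimes> z \<otimes> f (False # T)"
      by (rule eq2) (rule c f)+
    also have "\<dots> = dot_list R bs0 (z # zs) \<otimes> f S"
      unfolding IH using S bs False z b d f[of "False # T"] by (simp add: l_distr a_comm)
    finally show ?thesis .
  qed
qed simp

lemma mem_Idl_dot_list:
  assumes "set zs \<subseteq> carrier R" "x \<in> Idl (set zs)"
  shows "\<exists>bs. length bs = length zs \<and> set bs \<subseteq> carrier R \<and> x = dot_list R bs zs"
  using assms
proof (induction zs arbitrary: x)
  case Nil
  then show ?case by (simp add: Idl_empty)
next
  case (Cons z zs)
  then obtain b y where b: "b \<in> carrier R" "y \<in> Idl (set zs)" "x = b \<otimes> z \<oplus> y"
    using mem_Idl_insert[of z "set zs" x] by auto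
  with Cons obtain bs where "length bs = length zs" "set bs \<subseteq> carrier R" "y = dot_list R bs zs" by auto
  with b show ?case by (intro exI[of _ "b # bs"]) auto
qed

lemma kdiff_vanishes_below:
  assumes "set zs \<subseteq> carrier R" "vanishes_below R (length zs) (Suc k) f"
  shows "vanishes_below R (length zs) k (kdiff R zs f)"
  using assms
proof (induction zs arbitrary: f k)
  case (Cons z zs)
  have "kdiff R (z # zs) f S = \<zero>" if S: "length S = Suc (length zs)" "trues S < k" for S
  proof -
    obtain b T where T: "S = b # T" "length T = length zs" using S by (cases S) auto
    show ?thesis
    proof (cases b)
      case True
      then obtain k' where k: "k = Suc k'" using S T by (cases k) auto
      have "vanishes_below R (length zs) k' (kdiff R zs (\<lambda>T. f (True # T)))"
        using Cons.prems k by (intro Cons.IH) (auto simp: vanishes_below_def)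
      then show ?thesis using S T True k by (auto simp: vanishes_below_def)
    next
      case False
      have "vanishes_below R (length zs) k (kdiff R zs (\<lambda>T. f (False # T)))"
        using Cons.prems by (intro Cons.IH) (auto simp: vanishes_below_def)
      then show ?thesis using S T False Cons.prems by (auto simp: vanishes_below_def)
    qed
  qed
  then show ?case by (auto simp: vanishes_below_def)
qed (simp add: vanishes_below_def)

lemma khom_vanishes_below:
  assumes "set zs \<subseteq> carrier R" "vanishes_below R (length zs) k f"
  shows "vanishes_below R (length zs) (Suc k) (khom R zs f)"
  using assms
proof (induction zs arbitrary: f k)
  case (Cons z zs)
  have "khom R (z # zs) f S = \<zero>" if S: "length S = Suc (length zs)" "trues S < Suc k" for S
  proof -
    obtain b T where T: "S = b # T" "length T = length zs" using S by (cases S) auto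
    show ?thesis
    proof (cases b)
      case True
      then obtain k' where k: "k = Suc k'" using S T by (cases k) auto
      have "vanishes_below R (length zs) (Suc k') (khom R zs (\<lambda>T. f (True # T)))"
        using Cons.prems k by (intro Cons.IH) (auto simp: vanishes_below_def)
      then show ?thesis using S T True k Cons.prems by (auto simp: vanishes_below_def a_minus_def)
    next
      case False
      have "vanishes_below R (length zs) (Suc k) (khom R zs (\<lambda>T. f (False # T)))"
        using Cons.prems by (intro Cons.IH) (auto simp: vanishes_below_def)
      then show ?thesis using S T False Cons.prems by (auto simp: vanishes_below_def)
    qed
  qed
  then show ?case by (auto simp: vanishes_below_def)
qed (simp add: vanishes_below_def)

lemma Idl_ideal: "set xs \<subseteq> carrier R \<Longrightarrow> ideal (Idl (set xs)) R"
  by (rule genideal_ideal)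

text \<open>Since \<open>y\<close> is a nonzerodivisor modulo the ideal \<open>Y\<close>, exactness modulo \<open>Y + (y)\<close> allows to divide
  a boundary by \<open>y\<close>.\<close>

lemma koszul_divide:
  assumes zs: "set zs \<subseteq> carrier R" and Y: "ideal Y R" and Y': "ideal Y' R"
    and y: "y \<in> carrier R"
    and mem: "\<And>x. x \<in> Y' \<longleftrightarrow> (\<exists>b\<in>carrier R. \<exists>w\<in>Y. x = b \<otimes> y \<oplus> w)"
    and reg: "\<And>a. \<lbrakk>a \<in> carrier R; y \<otimes> a \<in> Y\<rbrakk> \<Longrightarrow> a \<in> Y"
    and exact: "\<And>h. \<lbrakk>\<And>T. h T \<in> carrier R; vanishes_below R (length zs) (Suc k) h;
        \<And>S. length S = length zs \<Longrightarrow> kdiff R zs h S \<in> Y'\<rbrakk> \<Longrightarrow>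
        \<exists>h'. (\<forall>T. h' T \<in> carrier R) \<and> vanishes_below R (length zs) (Suc (Suc k)) h' \<and>
          (\<forall>S. length S = length zs \<longrightarrow> h S \<ominus> kdiff R zs h' S \<in> Y')"
    and f: "\<And>T. f T \<in> carrier R" and g: "\<And>T. g T \<in> carrier R"
    and van: "vanishes_below R (length zs) (Suc k) g"
    and fg: "\<And>S. length S = length zs \<Longrightarrow> y \<otimes> f S \<ominus> kdiff R zs g S \<in> Y"
  shows "\<exists>u. (\<forall>T. u T \<in> carrier R) \<and> vanishes_below R (length zs) (Suc k) u \<and>
          (\<forall>S. length S = length zs \<longrightarrow> f S \<ominus> kdiff R zs u S \<in> Y)"
proof -
  let ?n = "length zs" and ?d = "kdiff R zs"
  have YY': "Y \<subseteq> Y'"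
  proof
    fix w assume w: "w \<in> Y"
    then have "w = \<zero> \<otimes> y \<oplus> w" using y ideal.Icarr[OF Y w] by simp
    with w show "w \<in> Y'" using mem by blast
  qed
  have yY': "y \<in> Y'"
    using mem[of y] ideal_zero[OF Y] y by (intro iffD2[OF mem] bexI[of _ \<one>] bexI[of _ \<zero>]) auto
  have "?d g S \<in> Y'" if S: "length S = ?n" for S
  proof -
    have c: "?d g S \<in> carrier R" using zs g by simp
    have "f S \<otimes> y \<in> Y'" using ideal_mult[OF Y' yY' f] .
    moreover have "y \<otimes> f S \<ominus> ?d g S \<in> Y'" using fg[OF S] YY' by blast
    ultimately have "f S \<otimes> y \<ominus> (y \<otimes> f S \<ominus> ?d g S) \<in> Y'" by (rule ideal_diff[OF Y'])
    also have "f S \<otimes> y \<ominus> (y \<otimes> f S \<ominus> ?d g S) = ?d g S" using c y f[of S] by algebra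
    finally show ?thesis .
  qed
  from exact[OF g van this] obtain g' where g': "\<And>T. g' T \<in> carrier R"
    and van': "vanishes_below R ?n (Suc (Suc k)) g'"
    and gg': "\<And>S. length S = ?n \<Longrightarrow> g S \<ominus> ?d g' S \<in> Y'" by blast
  have dvan: "vanishes_below R ?n (Suc k) (?d g')"
    by (rule kdiff_vanishes_below[OF zs van'])
  have "\<exists>u. u \<in> carrier R \<and> (length S = ?n \<longrightarrow> (g S \<ominus> ?d g' S) \<ominus> y \<otimes> u \<in> Y)
      \<and> (length S = ?n \<longrightarrow> trues S < Suc k \<longrightarrow> u = \<zero>)" for S
  proof (cases "length S = ?n")
    case len: True
    show ?thesis
    proof (cases "trues S < Suc k")
      case True
      then have "g S = \<zero>" "?d g' S = \<zero>" using van dvan len by (auto simp: vanishes_below_def)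
      then have "(g S \<ominus> ?d g' S) \<ominus> y \<otimes> \<zero> \<in> Y" using y ideal_zero[OF Y] by (simp add: a_minus_def)
      then show ?thesis by (intro exI[of _ \<zero>]) auto
    next
      case False
      obtain b w where b: "b \<in> carrier R" "w \<in> Y" "g S \<ominus> ?d g' S = b \<otimes> y \<oplus> w"
        using gg'[OF len] mem by blast
      have "(g S \<ominus> ?d g' S) \<ominus> y \<otimes> b = w"
        unfolding b(3) using b(1) y ideal.Icarr[OF Y b(2)] by algebra
      then show ?thesis using b False by (intro exI[of _ b]) auto
    qed
  qed auto
  then obtain u where u: "\<And>S. u S \<in> carrier R"
    and uY: "\<And>S. length S = ?n \<Longrightarrow> (g S \<ominus> ?d g' S) \<ominus> y \<otimes> u S \<in> Y"
    and uvan: "\<And>S. length S = ?n \<Longrightarrow> trues S < Suc k \<Longrightarrow> u S = \<zero>" by metis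
  have "f S \<ominus> ?d u S \<in> Y" if S: "length S = ?n" for S
  proof (rule reg)
    have c: "?d g S \<in> carrier R" "?d u S \<in> carrier R" "\<And>T. ?d g' T \<in> carrier R"
      using zs g u g' by auto
    show "f S \<ominus> ?d u S \<in> carrier R" using c f by simp
    have "?d (\<lambda>T. (g T \<ominus> ?d g' T) \<ominus> y \<otimes> u T) S \<in> Y"
      by (rule kdiff_mem_ideal[OF zs Y uY S])
    also have "?d (\<lambda>T. (g T \<ominus> ?d g' T) \<ominus> y \<otimes> u T) S = ?d g S \<ominus> y \<otimes> ?d u S"
      using zs g u g' y c f
      by (simp add: a_minus_def kdiff_add kdiff_minus kdiff_smult kdiff_kdiff)
    finally have "(y \<otimes> f S \<ominus> ?d g S) \<oplus> (?d g S \<ominus> y \<otimes> ?d u S) \<in> Y"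
      by (intro ideal_add Y fg S)
    also have "(y \<otimes> f S \<ominus> ?d g S) \<oplus> (?d g S \<ominus> y \<otimes> ?d u S) = y \<otimes> (f S \<ominus> ?d u S)"
      using c(1,2) y f[of S] by algebra
    finally show "y \<otimes> (f S \<ominus> ?d u S) \<in> Y" .
  qed
  with u uvan show ?thesis by (intro exI[of _ u]) (auto simp: vanishes_below_def)
qed

definition regular_list :: "'a list \<Rightarrow> bool" where
  "regular_list ys \<longleftrightarrow> set ys \<subseteq> carrier R \<and>
     (\<forall>i<length ys. \<forall>a\<in>carrier R. ys ! i \<otimes> a \<in> Idl (set (take i ys)) \<longrightarrow> a \<in> Idl (set (take i ys)))"

text \<open>Downward induction on \<open>k\<close>: for \<open>k = length zs\<close> there are no chains of degree above \<open>k\<close>, and in the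
  step a power of \<open>ys ! k\<close> is null-homotopic, so that this power can be cancelled by
  \<open>koszul_divide\<close>.\<close>

lemma koszul_exact:
  assumes zs: "set zs \<subseteq> carrier R" and ys: "regular_list ys" and len: "length ys = length zs"
    and pow: "\<And>y. y \<in> set ys \<Longrightarrow> \<exists>N::nat. y [^] N \<in> Idl (set zs)"
    and k: "k \<le> length zs"
    and f: "\<And>T. f T \<in> carrier R" "vanishes_below R (length zs) (Suc k) f"
      "\<And>S. length S = length zs \<Longrightarrow> kdiff R zs f S \<in> Idl (set (take k ys))"
  shows "\<exists>g. (\<forall>T. g T \<in> carrier R) \<and> vanishes_below R (length zs) (Suc (Suc k)) g \<and>
          (\<forall>S. length S = length zs \<longrightarrow> f S \<ominus> kdiff R zs g S \<in> Idl (set (take k ys)))"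
  using k f
proof (induction k arbitrary: f rule: inc_induct)
  case base
  have c: "set (take (length zs) ys) \<subseteq> carrier R" using ys len by (simp add: regular_list_def)
  have "f S = \<zero>" if "length S = length zs" for S
    using base(2) that length_filter_le[of id S] unfolding vanishes_below_def by auto
  moreover have "kdiff R zs (\<lambda>_. \<zero>) S = \<zero>" for S
    using kdiff_smult[OF zs, of "\<lambda>_. \<zero>" \<zero> S] zs by simp
  ultimately show ?case
    using ideal_zero[OF Idl_ideal[OF c]]
    by (intro exI[of _ "\<lambda>_. \<zero>"]) (auto simp: vanishes_below_def a_minus_def)
next
  case (step k)
  let ?n = "length zs" and ?d = "kdiff R zs" and ?y = "ys ! k"
  let ?Y = "Idl (set (take k ys))" and ?Y' = "Idl (set (take (Suc k) ys))"
  have ysc: "set ys \<subseteq> carrier R" using ys by (simp add: regular_list_def)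
  have c: "set (take k ys) \<subseteq> carrier R" "set (take (Suc k) ys) \<subseteq> carrier R"
    using ysc set_take_subset[of _ ys] by (meson subset_trans)+
  have Y: "ideal ?Y R" and Y': "ideal ?Y' R" using Idl_ideal c by auto
  have kl: "k < length ys" using step(2) len by simp
  then have y: "?y \<in> carrier R" "?y \<in> set ys" using ysc nth_mem by blast+
  have set': "set (take (Suc k) ys) = insert ?y (set (take k ys))"
    using kl by (simp add: take_Suc_conv_app_nth)
  have mem: "x \<in> ?Y' \<longleftrightarrow> (\<exists>b\<in>carrier R. \<exists>w\<in>?Y. x = b \<otimes> ?y \<oplus> w)" for x
    unfolding set' by (rule mem_Idl_insert[OF y(1) c(1)])
  have reg: "a \<in> ?Y" if "a \<in> carrier R" "?y \<otimes> a \<in> ?Y" for a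
    using ys kl that unfolding regular_list_def by blast
  have divide: "\<exists>u. (\<forall>T. u T \<in> carrier R) \<and> vanishes_below R ?n (Suc (Suc k)) u \<and>
          (\<forall>S. length S = ?n \<longrightarrow> f S \<ominus> ?d u S \<in> ?Y)"
    if "\<And>T. f T \<in> carrier R" "\<And>T. g T \<in> carrier R" "vanishes_below R ?n (Suc (Suc k)) g"
      "\<And>S. length S = ?n \<Longrightarrow> ?y [^] (s::nat) \<otimes> f S \<ominus> ?d g S \<in> ?Y" for f g s
    using that
  proof (induction s arbitrary: g)
    case 0
    then show ?case by (intro exI[of _ g]) auto
  next
    case (Suc s)
    have "?y [^] Suc s \<otimes> f S = ?y \<otimes> (?y [^] s \<otimes> f S)" for S
      using y Suc.prems(1)[of S] by (simp add: m_ac)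
    then have *: "?y \<otimes> (?y [^] s \<otimes> f S) \<ominus> ?d g S \<in> ?Y" if "length S = ?n" for S
      using Suc.prems(4)[OF that] by metis
    have "\<exists>u. (\<forall>T. u T \<in> carrier R) \<and> vanishes_below R ?n (Suc (Suc k)) u \<and>
          (\<forall>S. length S = ?n \<longrightarrow> ?y [^] s \<otimes> f S \<ominus> ?d u S \<in> ?Y)"
    proof (rule koszul_divide[OF zs Y Y' y(1) mem reg step.IH _ Suc.prems(2,3)])
      show "\<And>S. length S = ?n \<Longrightarrow> ?y \<otimes> (?y [^] s \<otimes> f S) \<ominus> ?d g S \<in> ?Y" by (rule *)
    qed (use y Suc.prems in auto)
    then obtain u where "\<And>T. u T \<in> carrier R" "vanishes_below R ?n (Suc (Suc k)) u"
      "\<And>S. length S = ?n \<Longrightarrow> ?y [^] s \<otimes> f S \<ominus> ?d u S \<in> ?Y" by blast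
    then show ?case by (rule Suc.IH[OF Suc.prems(1)])
  qed
  from pow[OF y(2)] obtain N :: nat where "?y [^] N \<in> Idl (set zs)" by blast
  with mem_Idl_dot_list[OF zs] obtain bs where bs: "length bs = ?n" "set bs \<subseteq> carrier R"
    "?y [^] N = dot_list R bs zs" by blast
  show ?case
  proof (rule divide)
    show "khom R bs f T \<in> carrier R" for T using bs step.prems by simp
    show "vanishes_below R ?n (Suc (Suc k)) (khom R bs f)"
      using khom_vanishes_below[OF bs(2), of "Suc k" f] bs(1) step.prems by simp
    show "?y [^] N \<otimes> f S \<ominus> ?d (khom R bs f) S \<in> ?Y" if S: "length S = ?n" for S
    proof -
      have c: "?d (khom R bs f) S \<in> carrier R" "khom R bs (?d f) S \<in> carrier R"
        using zs bs step.prems by auto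
      have "?y [^] N \<otimes> f S \<ominus> ?d (khom R bs f) S
          = (?d (khom R bs f) S \<oplus> khom R bs (?d f) S) \<ominus> ?d (khom R bs f) S"
        using kdiff_khom[OF zs bs(2) step.prems(1) bs(1) S] bs(3) by simp
      also have "\<dots> = khom R bs (?d f) S" using c by algebra
      also have "\<dots> \<in> ?Y"
        using bs S step.prems(3) by (intro khom_mem_ideal Y) auto
      finally show ?thesis .
    qed
  qed (rule step.prems)
qed

lemma kdiff_degree_zero:
  assumes "set zs \<subseteq> carrier R" "\<And>T. trues T \<noteq> 0 \<Longrightarrow> f T = \<zero>"
  shows "kdiff R zs f S = \<zero>"
  using assms by (induction zs arbitrary: f S) (auto simp: filter_empty_conv)

lemma kdiff_lift:
  assumes "set zs \<subseteq> carrier R" "x \<in> Idl (set zs)"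
  shows "\<exists>f. (\<forall>T. f T \<in> carrier R) \<and> (\<forall>T. trues T = 0 \<longrightarrow> f T = \<zero>) \<and>
    (\<forall>S. length S = length zs \<longrightarrow> kdiff R zs f S = (if trues S = 0 then x else \<zero>))"
  using assms
proof (induction zs arbitrary: x)
  case Nil
  then show ?case by (intro exI[of _ "\<lambda>_. \<zero>"]) (auto simp: Idl_empty)
next
  case (Cons z zs)
  then obtain b y where b: "b \<in> carrier R" "y \<in> Idl (set zs)" "x = b \<otimes> z \<oplus> y"
    using mem_Idl_insert[of z "set zs" x] by auto
  have z: "z \<in> carrier R" "set zs \<subseteq> carrier R" using Cons.prems by auto
  obtain f where f: "\<forall>T. f T \<in> carrier R" "\<forall>T. trues T = 0 \<longrightarrow> f T = \<zero>"
    "\<forall>S. length S = length zs \<longrightarrow> kdiff R zs f S = (if trues S = 0 then y else \<zero>)"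
    using Cons.IH[OF z(2) b(2)] by blast
  have y: "y \<in> carrier R" using ideal.Icarr[OF Idl_ideal[OF z(2)] b(2)] .
  define h where "h = (\<lambda>S. case S of [] \<Rightarrow> \<zero> |
      s # T \<Rightarrow> if s then (if trues T = 0 then b else \<zero>) else f T)"
  have "kdiff R zs (\<lambda>T. h (True # T)) U = \<zero>" for U
    by (rule kdiff_degree_zero[OF z(2)]) (simp add: h_def)
  moreover have "(\<lambda>T. h (False # T)) = f" by (simp add: h_def)
  ultimately have "kdiff R (z # zs) h S = (if trues S = 0 then x else \<zero>)"
    if "length S = length (z # zs)" for S
    using that f b z y by (cases S) (auto simp: h_def m_comm a_comm)
  moreover have "h T \<in> carrier R" "trues T = 0 \<longrightarrow> h T = \<zero>" for T
    using f b by (auto simp: h_def split: list.splits)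
  ultimately show ?case by blast
qed

lemma colon_mem:
  assumes zs: "set (z # zs) \<subseteq> carrier R" and ys: "regular_list ys" and len: "length ys = length (z # zs)"
    and pow: "\<And>y. y \<in> set ys \<Longrightarrow> \<exists>N::nat. y [^] N \<in> Idl (set (z # zs))"
    and a: "a \<in> carrier R" "a \<otimes> z \<in> Idl (set zs)"
  shows "a \<in> Idl (set zs)"
proof -
  have z: "z \<in> carrier R" "set zs \<subseteq> carrier R" using zs by auto
  note I = Idl_ideal[OF z(2)]
  obtain f where f: "\<forall>T. f T \<in> carrier R" "\<forall>T. trues T = 0 \<longrightarrow> f T = \<zero>"
    "\<forall>S. length S = length zs \<longrightarrow> kdiff R zs f S = (if trues S = 0 then \<ominus> (a \<otimes> z) else \<zero>)"
    using kdiff_lift[OF z(2) ideal_neg[OF I a(2)]] by blast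
  define h where "h = (\<lambda>S. case S of [] \<Rightarrow> \<zero> |
      s # T \<Rightarrow> if s then (if trues T = 0 then a else \<zero>) else f T)"
  have "kdiff R zs (\<lambda>T. h (True # T)) U = \<zero>" for U
    by (rule kdiff_degree_zero[OF z(2)]) (simp add: h_def)
  moreover have "(\<lambda>T. h (False # T)) = f" by (simp add: h_def)
  ultimately have d: "kdiff R (z # zs) h S = \<zero>" if "length S = length (z # zs)" for S
    using that f z a by (cases S) (auto simp: h_def m_comm l_neg)
  have h: "h T \<in> carrier R" "trues T = 0 \<longrightarrow> h T = \<zero>" for T
    using f a by (auto simp: h_def split: list.splits)
  have "\<exists>g. (\<forall>T. g T \<in> carrier R) \<and> vanishes_below R (length (z # zs)) (Suc (Suc 0)) g \<and>
          (\<forall>S. length S = length (z # zs) \<longrightarrow> h S \<ominus> kdiff R (z # zs) g S \<in> Idl (set (take 0 ys)))"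
  proof (rule koszul_exact[OF zs ys len pow])
    show "vanishes_below R (length (z # zs)) (Suc 0) h" using h by (simp add: vanishes_below_def)
    show "kdiff R (z # zs) h S \<in> Idl (set (take 0 ys))" if "length S = length (z # zs)" for S
      using d[OF that] by (simp add: Idl_empty)
  qed (auto intro: h)
  then obtain g where g: "\<And>T. g T \<in> carrier R"
    "\<And>S. length S = length (z # zs) \<Longrightarrow> h S \<ominus> kdiff R (z # zs) g S = \<zero>"
    by (auto simp: Idl_empty)
  let ?T = "replicate (length zs) False"
  let ?e = "kdiff R zs (\<lambda>T. g (True # T)) ?T"
  have "?e \<in> Idl (set zs)" using g by (intro kdiff_mem_Idl z)
  moreover have "a \<ominus> \<ominus> ?e = \<zero>" using g(2)[of "True # ?T"] by (simp add: h_def)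
  moreover have "a = (a \<ominus> \<ominus> e) \<ominus> e" if "e \<in> carrier R" for e using a(1) that by algebra
  ultimately show ?thesis using ideal_diff[OF I ideal_zero[OF I]] ideal.Icarr[OF I] by metis
qed

end

section \<open>Monomials in parameters\<close>

primrec power_prod :: "('a, 'b) ring_scheme \<Rightarrow> 'a list \<Rightarrow> nat list \<Rightarrow> 'a" where
  "power_prod R [] ns = \<one>\<^bsub>R\<^esub>"
| "power_prod R (z # zs) ns = z [^]\<^bsub>R\<^esub> hd ns \<otimes>\<^bsub>R\<^esub> power_prod R zs (tl ns)"

definition exponents :: "nat \<Rightarrow> nat \<Rightarrow> nat list set" where
  "exponents d n = {ns. length ns = d \<and> sum_list ns = n}"

definition succ_powers :: "('a, 'b) ring_scheme \<Rightarrow> 'a list \<Rightarrow> nat list \<Rightarrow> 'a list" where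
  "succ_powers R zs ns = map2 (\<lambda>z n. z [^]\<^bsub>R\<^esub> Suc n) zs ns"

lemma finite_exponents: "finite (exponents d n)"
proof (rule finite_subset)
  show "exponents d n \<subseteq> {ns. set ns \<subseteq> {..n} \<and> length ns = d}"
    using member_le_sum_list by (force simp: exponents_def)
qed (rule finite_lists_length_eq, simp)

lemma exponents_zero: "exponents d 0 = {replicate d 0}"
  by (auto simp: exponents_def intro!: replicate_eqI)

lemma card_exponents: "card (exponents d n) = (n + d - 1) choose n"
  unfolding exponents_def by (rule card_length_sum_list)

lemma exponents_differ:
  fixes \<alpha> \<beta> :: "nat list"
  assumes "length \<beta> = length \<alpha>" "sum_list \<alpha> \<le> sum_list \<beta>" "\<beta> \<noteq> \<alpha>"
  shows "\<exists>i<length \<alpha>. \<alpha> ! i < \<beta> ! i"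
  using assms
proof (induction \<beta> \<alpha> rule: list_induct2)
  case (Cons b \<beta> a \<alpha>)
  show ?case
  proof (cases "a < b")
    case True
    then show ?thesis by (intro exI[of _ 0]) auto
  next
    case False
    then have "sum_list \<alpha> \<le> sum_list \<beta>" "\<beta> \<noteq> \<alpha>" using Cons.prems by auto
    then have "\<exists>i<length \<alpha>. \<alpha> ! i < \<beta> ! i" by (rule Cons.IH)
    then show ?thesis by auto
  qed
qed simp

context cring
begin

lemma pow_sum_mem:
  assumes J: "ideal J R" and ab: "a \<in> carrier R" "b \<in> carrier R"
    and u: "u \<in> carrier R" "a [^] (m::nat) \<otimes> u \<in> J" "b [^] (n::nat) \<otimes> u \<in> J"
  shows "(a \<oplus> b) [^] (m + n) \<otimes> u \<in> J"
  using u
proof (induction "m + n" arbitrary: m n u)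
  case (Suc k)
  show ?case
  proof (cases "m = 0 \<or> n = 0")
    case True
    then have "u \<in> J" using Suc.prems by auto
    then show ?thesis using ideal_mult[OF J] ab by simp
  next
    case False
    then obtain m' n' where mn: "m = Suc m'" "n = Suc n'" by (meson not0_implies_Suc)
    have "(a \<oplus> b) [^] (m' + n) \<otimes> (a \<otimes> u) \<in> J"
    proof (rule Suc.hyps)
      show "a [^] m' \<otimes> (a \<otimes> u) \<in> J" using Suc.prems(1,2) ab mn by (simp add: m_assoc)
      have "b [^] n \<otimes> (a \<otimes> u) = a \<otimes> (b [^] n \<otimes> u)" using Suc.prems ab by (simp add: m_lcomm)
      then show "b [^] n \<otimes> (a \<otimes> u) \<in> J" using ideal_mult[OF J Suc.prems(3) ab(1)] by simp
    qed (use Suc mn ab in auto)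
    moreover have "(a \<oplus> b) [^] (m + n') \<otimes> (b \<otimes> u) \<in> J"
    proof (rule Suc.hyps)
      show "b [^] n' \<otimes> (b \<otimes> u) \<in> J" using Suc.prems(1,3) ab mn by (simp add: m_assoc)
      have "a [^] m \<otimes> (b \<otimes> u) = b \<otimes> (a [^] m \<otimes> u)" using Suc.prems ab by (simp add: m_lcomm)
      then show "a [^] m \<otimes> (b \<otimes> u) \<in> J" using ideal_mult[OF J Suc.prems(2) ab(2)] by simp
    qed (use Suc mn ab in auto)
    moreover have "(a \<oplus> b) [^] (m + n) \<otimes> u
        = (a \<oplus> b) [^] (m' + n) \<otimes> (a \<otimes> u) \<oplus> (a \<oplus> b) [^] (m + n') \<otimes> (b \<otimes> u)"
    proof -
      have e: "m + n = Suc (m' + n)" "m + n' = m' + n" using mn by auto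
      have "(a \<oplus> b) [^] (m' + n) \<in> carrier R" using ab by simp
      then show ?thesis unfolding e nat_pow_Suc using ab Suc.prems(1)
        by (simp add: l_distr r_distr m_assoc)
    qed
    ultimately show ?thesis using ideal_add[OF J] by simp
  qed
qed simp

lemma pow_mem_Idl:
  assumes J: "ideal J R" and "finite A" "A \<subseteq> carrier R"
    and "\<And>z. z \<in> A \<Longrightarrow> \<exists>n::nat. z [^] n \<in> J" and "x \<in> Idl A"
  shows "\<exists>n::nat. x [^] n \<in> J"
  using assms(2-)
proof (induction A arbitrary: x rule: finite_induct)
  case empty
  then show ?case using ideal_zero[OF J] by (intro exI[of _ 1]) (auto simp: Idl_empty)
next
  case (insert z A)
  then obtain b y where b: "b \<in> carrier R" "y \<in> Idl A" "x = b \<otimes> z \<oplus> y"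
    using mem_Idl_insert[of z A x] by auto
  have c: "z \<in> carrier R" "y \<in> carrier R"
    using insert.prems ideal.Icarr[OF genideal_ideal b(2)] by auto
  obtain n :: nat where n: "z [^] n \<in> J" using insert.prems(2)[of z] by auto
  have "\<exists>m::nat. y [^] m \<in> J"
    using insert.prems by (intro insert.IH[OF _ _ b(2)]) auto
  then obtain m :: nat where m: "y [^] m \<in> J" by (elim exE)
  have "(b \<otimes> z) [^] n \<in> J"
    using ideal_mult[OF J n, of "b [^] n"] b c by (simp add: nat_pow_distrib)
  then have "x [^] (n + m) \<otimes> \<one> \<in> J"
    unfolding b(3) using b c m by (intro pow_sum_mem J) auto
  then show ?case using b c by (intro exI[of _ "n + m"]) simp
qed

lemma Idl_mult_mem:
  assumes K: "ideal K R" and "A \<subseteq> carrier R" "B \<subseteq> carrier R"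
    and AB: "\<And>a b. \<lbrakk>a \<in> A; b \<in> B\<rbrakk> \<Longrightarrow> a \<otimes> b \<in> K" and xy: "x \<in> Idl A" "y \<in> Idl B"
  shows "x \<otimes> y \<in> K"
proof -
  have id: "ideal {a \<in> carrier R. \<forall>b\<in>C. a \<otimes> b \<in> K} R" if "C \<subseteq> carrier R" for C
  proof (rule idealI_cring)
    fix a x assume "a \<in> carrier R" "x \<in> {a \<in> carrier R. \<forall>b\<in>C. a \<otimes> b \<in> K}"
    then show "a \<otimes> x \<in> {a \<in> carrier R. \<forall>b\<in>C. a \<otimes> b \<in> K}"
      using that ideal_mult[OF K, of _ a] by (auto simp: m_assoc subset_iff)
  qed (use that K in \<open>auto simp: l_distr subset_iff ideal_add ideal_zero\<close>)
  have 1: "Idl A \<subseteq> {a \<in> carrier R. \<forall>b\<in>B. a \<otimes> b \<in> K}"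
    using AB assms(2,3) by (intro genideal_minimal id) auto
  have c: "x \<in> carrier R" using xy(1) 1 by auto
  have "Idl B \<subseteq> {b \<in> carrier R. \<forall>a\<in>{x}. b \<otimes> a \<in> K}"
  proof (intro genideal_minimal id subsetI CollectI conjI ballI)
    fix b a assume b: "b \<in> B" and "a \<in> {x}"
    then have "x \<otimes> b \<in> K" "a = x" using 1 xy by auto
    then show "b \<otimes> a \<in> K" using m_comm[OF c, of b] subsetD[OF assms(3) b] by simp
  qed (use c assms in auto)
  with xy(2) have "y \<in> carrier R" "y \<otimes> x \<in> K" by auto
  then show ?thesis using m_comm[OF c, of y] by simp
qed

lemma ideal_prod_subset:
  assumes "ideal K R" "\<And>x y. \<lbrakk>x \<in> I; y \<in> J\<rbrakk> \<Longrightarrow> x \<otimes> y \<in> K"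
  shows "ideal_prod R I J \<subseteq> K"
proof
  fix x assume "x \<in> ideal_prod R I J"
  then show "x \<in> K" by induction (use assms ideal_add in auto)
qed

definition param_list :: "'a list \<Rightarrow> bool" where
  "param_list zs \<longleftrightarrow> set zs \<subseteq> carrier R \<and>
     (\<exists>ys. regular_list ys \<and> length ys = length zs \<and> (\<forall>y\<in>set ys. \<exists>N::nat. y [^] N \<in> Idl (set zs)))"

lemma param_list_carrier: "param_list zs \<Longrightarrow> set zs \<subseteq> carrier R"
  by (simp add: param_list_def)

lemma param_list_transfer:
  assumes zs: "param_list zs" and "length us = length zs" "set us \<subseteq> carrier R"
    and "\<And>z. z \<in> set zs \<Longrightarrow> \<exists>n::nat. z [^] n \<in> Idl (set us)"
  shows "param_list us"
proof -
  obtain ys where ys: "regular_list ys" "length ys = length zs"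
    "\<forall>y\<in>set ys. \<exists>N::nat. y [^] N \<in> Idl (set zs)" using zs by (auto simp: param_list_def)
  have "\<exists>N::nat. y [^] N \<in> Idl (set us)" if y: "y \<in> set ys" for y
  proof -
    obtain N :: nat where N: "y [^] N \<in> Idl (set zs)"
      using bspec[OF ys(3) y] by (elim exE)
    have "\<exists>n::nat. (y [^] N) [^] n \<in> Idl (set us)"
    proof (rule pow_mem_Idl[OF Idl_ideal[OF assms(3)] finite_set _ _ N])
      show "set zs \<subseteq> carrier R" using zs by (simp add: param_list_def)
    qed (rule assms(4))
    then obtain n :: nat where "(y [^] N) [^] n \<in> Idl (set us)" by blast
    moreover have "y \<in> carrier R" using ys(1) y by (auto simp: regular_list_def)
    ultimately have "y [^] (N * n) \<in> Idl (set us)" by (simp add: nat_pow_pow)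
    then show ?thesis by blast
  qed
  with ys assms show ?thesis by (auto simp: param_list_def)
qed

lemma param_list_colon:
  assumes "param_list (z # zs)" "a \<in> carrier R" "a \<otimes> z \<in> Idl (set zs)"
  shows "a \<in> Idl (set zs)"
  using assms colon_mem unfolding param_list_def by metis

lemma power_prod_closed [simp]: "set zs \<subseteq> carrier R \<Longrightarrow> power_prod R zs ns \<in> carrier R"
  by (induction zs arbitrary: ns) auto

lemma succ_powers_closed:
  assumes "set zs \<subseteq> carrier R"
  shows "set (succ_powers R zs ns) \<subseteq> carrier R"
proof
  fix x assume "x \<in> set (succ_powers R zs ns)"
  then obtain z n where "z \<in> set zs" "x = z [^] Suc n"
    unfolding succ_powers_def by (auto dest: set_zip_leftD)
  then show "x \<in> carrier R" using assms nat_pow_closed by blast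
qed

lemma mem_Idl_set: "\<lbrakk>set zs \<subseteq> carrier R; z \<in> set zs\<rbrakk> \<Longrightarrow> z \<in> Idl (set zs)"
  using genideal_self by blast

text \<open>The exponents are reduced to \<open>1\<close> one variable at a time, starting with the head of \<open>zs\<close>; the
  variables in \<open>us\<close> are already done.\<close>

lemma power_prod_colon_aux:
  assumes "param_list (us @ zs)" "length ns = length zs" "a \<in> carrier R"
    and "a \<otimes> power_prod R zs ns \<in> Idl (set (us @ succ_powers R zs ns))"
  shows "a \<in> Idl (set (us @ zs))"
  using assms
proof (induction zs arbitrary: us ns)
  case Nil
  then show ?case by (simp add: succ_powers_def)
next
  case (Cons z zs us ns0)
  from Cons.prems(2)
  obtain n ns where ns: "ns0 = n # ns" "length ns = length zs" by (cases ns0) auto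
  have c: "z \<in> carrier R" "set zs \<subseteq> carrier R" "set us \<subseteq> carrier R"
    using Cons.prems(1) by (auto simp: param_list_def)
  let ?W = "us @ succ_powers R zs ns"
  have W: "set ?W \<subseteq> carrier R" using c succ_powers_closed by auto
  let ?m = "power_prod R zs ns"
  have m: "?m \<in> carrier R" using c by simp
  have z: "z [^] k \<in> carrier R" for k :: nat using c by simp
  have "set (us @ succ_powers R (z # zs) ns0) = insert (z [^] Suc n) (set ?W)"
    using ns by (auto simp: succ_powers_def)
  then have "a \<otimes> (z [^] n \<otimes> ?m) \<in> Idl (insert (z [^] Suc n) (set ?W))"
    using Cons.prems(4) ns by simp
  then obtain b y where b: "b \<in> carrier R" "y \<in> Idl (set ?W)"
    "a \<otimes> (z [^] n \<otimes> ?m) = b \<otimes> (z [^] Suc n) \<oplus> y"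
    unfolding mem_Idl_insert[OF z W] by blast
  have y: "y \<in> carrier R" using ideal.Icarr[OF Idl_ideal[OF W] b(2)] .
  have "a \<otimes> (z [^] n \<otimes> ?m) \<ominus> b \<otimes> (z [^] n \<otimes> z) = y"
    unfolding b(3) nat_pow_Suc using b(1) y z[of n] c(1) by algebra
  moreover have "(a \<otimes> ?m \<ominus> b \<otimes> z) \<otimes> z [^] n = a \<otimes> (z [^] n \<otimes> ?m) \<ominus> b \<otimes> (z [^] n \<otimes> z)"
    using m c(1) b(1) z[of n] Cons.prems(3) by algebra
  ultimately have col: "(a \<otimes> ?m \<ominus> b \<otimes> z) \<otimes> z [^] n \<in> Idl (set ?W)" using b(2) by simp
  have amb: "a \<otimes> ?m \<ominus> b \<otimes> z \<in> carrier R" using m c b Cons.prems(3) by simp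
  have "a \<otimes> ?m \<ominus> b \<otimes> z \<in> Idl (set ?W)"
  proof (cases "n = 0")
    case True
    then show ?thesis using col amb by simp
  next
    case False
    have "param_list (z [^] n # ?W)"
    proof (rule param_list_transfer[OF Cons.prems(1)])
      show len: "length (z [^] n # ?W) = length (us @ z # zs)" using ns by (simp add: succ_powers_def)
      show cc: "set (z [^] n # ?W) \<subseteq> carrier R" using z W by simp
      show "\<exists>k::nat. w [^] k \<in> Idl (set (z [^] n # ?W))" if w: "w \<in> set (us @ z # zs)" for w
      proof -
        have "\<exists>k::nat. w [^] k \<in> set (z [^] n # ?W)"
        proof -
          consider "w \<in> set us" | "w = z" | "w \<in> set zs" using w by auto
          then show ?thesis
          proof cases
            case 1
            then have "w [^] (1::nat) = w" using c by auto
            then show ?thesis using 1 by (intro exI[of _ 1]) auto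
          next
            case 3
            then obtain i where "i < length zs" "w = zs ! i" by (auto simp: in_set_conv_nth)
            then have "w [^] Suc (ns ! i) \<in> set (succ_powers R zs ns)"
              unfolding succ_powers_def in_set_conv_nth using ns by (intro exI[of _ i]) auto
            then show ?thesis by (intro exI[of _ "Suc (ns ! i)"]) simp
          qed auto
        qed
        then show ?thesis using mem_Idl_set[OF cc] by blast
      qed
    qed
    then show ?thesis by (rule param_list_colon[OF _ amb col])
  qed
  then have "a \<otimes> ?m \<in> Idl (insert z (set ?W))"
    unfolding mem_Idl_insert[OF c(1) W]
  proof (intro bexI)
    show "a \<otimes> ?m = b \<otimes> z \<oplus> (a \<otimes> ?m \<ominus> b \<otimes> z)"
      using m c(1) b(1) Cons.prems(3) by algebra
  qed (use b in auto)
  then have "a \<otimes> ?m \<in> Idl (set ((z # us) @ succ_powers R zs ns))" by simp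
  moreover have "param_list ((z # us) @ zs)"
    using Cons.prems(1) by (auto simp: param_list_def)
  ultimately have "a \<in> Idl (set ((z # us) @ zs))"
    using Cons.IH[of "z # us" ns] ns(2) Cons.prems(3) by blast
  then show ?case by simp
qed

lemma power_prod_colon:
  assumes "param_list zs" "length ns = length zs" "a \<in> carrier R"
    and "a \<otimes> power_prod R zs ns \<in> Idl (set (succ_powers R zs ns))"
  shows "a \<in> Idl (set zs)"
  using power_prod_colon_aux[of "[]" zs ns a] assms by simp

lemma power_prod_mem_pow:
  assumes "set zs \<subseteq> carrier R" "length ns = length zs" "i < length zs" "k \<le> ns ! i"
  shows "\<exists>b\<in>carrier R. power_prod R zs ns = b \<otimes> zs ! i [^] k"
  using assms
proof (induction zs arbitrary: ns i)
  case (Cons z zs ns0)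
  from Cons.prems(2)
  obtain n ns where ns: "ns0 = n # ns" "length ns = length zs" by (cases ns0) auto
  have c: "z \<in> carrier R" "power_prod R zs ns \<in> carrier R" using Cons.prems by auto
  show ?case
  proof (cases i)
    case 0
    have "z [^] n = z [^] (n - k) \<otimes> z [^] k"
      using Cons.prems(4) ns c 0 by (simp add: nat_pow_mult)
    then have "power_prod R (z # zs) ns0 = (z [^] (n - k) \<otimes> power_prod R zs ns) \<otimes> z [^] k"
      using ns c by (simp add: m_ac)
    then show ?thesis using 0 c by auto
  next
    case (Suc j)
    then obtain b where b: "b \<in> carrier R" "power_prod R zs ns = b \<otimes> zs ! j [^] k"
      using Cons.IH[of ns j] Cons.prems ns by auto
    have "zs ! j \<in> carrier R" using Cons.prems Suc by (auto simp: subset_iff)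
    then have "power_prod R (z # zs) ns0 = (z [^] n \<otimes> b) \<otimes> zs ! j [^] k"
      using b c ns by (simp add: m_assoc)
    then show ?thesis using Suc b c by auto
  qed
qed simp

lemma power_prod_mem_succ_powers:
  assumes zs: "set zs \<subseteq> carrier R" and len: "length \<alpha> = length zs" "length \<beta> = length zs"
    and "sum_list \<alpha> \<le> sum_list \<beta>" "\<beta> \<noteq> \<alpha>"
  shows "power_prod R zs \<beta> \<in> Idl (set (succ_powers R zs \<alpha>))"
proof -
  obtain i where i: "i < length zs" "Suc (\<alpha> ! i) \<le> \<beta> ! i"
    using exponents_differ[of \<beta> \<alpha>] assms by auto
  obtain b where b: "b \<in> carrier R" "power_prod R zs \<beta> = b \<otimes> zs ! i [^] Suc (\<alpha> ! i)"
    using power_prod_mem_pow[OF zs len(2) i] by blast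
  have "zs ! i [^] Suc (\<alpha> ! i) \<in> set (succ_powers R zs \<alpha>)"
    unfolding succ_powers_def in_set_conv_nth using i len by (intro exI[of _ i]) auto
  then show ?thesis
    unfolding b(2) using mem_Idl_set[OF succ_powers_closed[OF zs]] b(1)
      ideal_mult[OF Idl_ideal[OF succ_powers_closed[OF zs]]] by metis
qed

lemma power_prod_update:
  assumes "set zs \<subseteq> carrier R" "length ns = length zs" "i < length zs"
  shows "power_prod R zs (ns[i := Suc (ns ! i)]) = power_prod R zs ns \<otimes> zs ! i"
  using assms
proof (induction zs arbitrary: ns i)
  case (Cons z zs ns0)
  from Cons.prems(2)
  obtain n ns where ns: "ns0 = n # ns" "length ns = length zs" by (cases ns0) auto
  have c: "z \<in> carrier R" "power_prod R zs ns \<in> carrier R" using Cons.prems by auto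
  show ?case
  proof (cases i)
    case 0
    then show ?thesis using c ns by (simp add: m_ac)
  next
    case (Suc j)
    have "zs ! j \<in> carrier R" using Cons.prems Suc by (auto simp: subset_iff)
    then show ?thesis using Cons.IH[of ns j] Cons.prems ns c Suc by (simp add: m_assoc)
  qed
qed simp

lemma power_prod_zero: "power_prod R zs (replicate (length zs) 0) = \<one>"
  by (induction zs) auto

lemma one_ideals_set [simp]: "\<one>\<^bsub>ideals_set R\<^esub> = carrier R"
  by (simp add: ideals_set_def)

lemma mult_ideals_set [simp]: "I \<otimes>\<^bsub>ideals_set R\<^esub> J = ideal_prod R I J"
  by (simp add: ideals_set_def)

lemma ideal_pow_ideal: "ideal I R \<Longrightarrow> ideal (ideal_pow R I n) R"
  by (induction n) (auto simp: oneideal ideal_prod_is_ideal)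

lemma power_prod_in_carrier: "set zs \<subseteq> carrier R \<Longrightarrow> power_prod R zs ` A \<subseteq> carrier R"
  by auto

lemma ideal_pow_power_prod:
  assumes zs: "set zs \<subseteq> carrier R"
  shows "ideal_pow R (Idl (set zs)) n = Idl (power_prod R zs ` exponents (length zs) n)"
proof (induction n)
  case 0
  show ?case by (simp add: exponents_zero power_prod_zero genideal_one)
next
  case (Suc n)
  let ?M = "\<lambda>n. power_prod R zs ` exponents (length zs) n"
  have M: "ideal (Idl (?M n)) R" for n by (rule genideal_ideal[OF power_prod_in_carrier[OF zs]])
  have I: "ideal (Idl (set zs)) R" by (rule Idl_ideal[OF zs])
  have "ideal_prod R (Idl (?M n)) (Idl (set zs)) = Idl (?M (Suc n))"
  proof
    show "ideal_prod R (Idl (?M n)) (Idl (set zs)) \<subseteq> Idl (?M (Suc n))"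
    proof (rule ideal_prod_subset[OF M])
      fix x y assume xy: "x \<in> Idl (?M n)" "y \<in> Idl (set zs)"
      show "x \<otimes> y \<in> Idl (?M (Suc n))"
      proof (rule Idl_mult_mem[OF M power_prod_in_carrier[OF zs] zs _ xy])
        fix a b assume "a \<in> ?M n" and b: "b \<in> set zs"
        then obtain ns where ns: "ns \<in> exponents (length zs) n" "a = power_prod R zs ns" by blast
        obtain i where i: "i < length zs" "b = zs ! i" using b by (auto simp: in_set_conv_nth)
        have "a \<otimes> b = power_prod R zs (ns[i := Suc (ns ! i)])"
          using power_prod_update[OF zs, of ns i] ns i by (simp add: exponents_def)
        moreover have "ns[i := Suc (ns ! i)] \<in> exponents (length zs) (Suc n)"
        proof -
          have "sum_list (ns[i := Suc (ns ! i)]) = Suc n"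
            using ns i elem_le_sum_list[of i ns] by (simp add: exponents_def sum_list_update)
          with ns show ?thesis by (simp add: exponents_def)
        qed
        ultimately have "a \<otimes> b \<in> ?M (Suc n)" by (rule image_eqI)
        then show "a \<otimes> b \<in> Idl (?M (Suc n))"
          using genideal_self[OF power_prod_in_carrier[OF zs]] by blast
      qed
    qed
    show "Idl (?M (Suc n)) \<subseteq> ideal_prod R (Idl (?M n)) (Idl (set zs))"
    proof (rule genideal_minimal[OF ideal_prod_is_ideal[OF M I]], rule subsetI)
      fix x assume "x \<in> ?M (Suc n)"
      then obtain ns where ns: "length ns = length zs" "sum_list ns = Suc n" "x = power_prod R zs ns"
        by (auto simp: exponents_def)
      have "\<exists>i<length ns. ns ! i \<noteq> 0"
      proof (rule ccontr)
        assume "\<not> ?thesis"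
        then have "\<forall>m\<in>set ns. m = 0" by (metis in_set_conv_nth)
        then have "sum_list ns = 0" by (simp add: sum_list_eq_0_iff)
        with ns show False by simp
      qed
      then obtain i k where i: "i < length ns" "ns ! i = Suc k" by (meson not0_implies_Suc)
      let ?ns = "ns[i := k]"
      have "?ns[i := Suc (?ns ! i)] = ns" using i by (simp add: list_update_same_conv)
      then have "x = power_prod R zs ?ns \<otimes> zs ! i"
        using power_prod_update[OF zs, of ?ns i] ns i by simp
      moreover have "?ns \<in> exponents (length zs) n"
        using ns i elem_le_sum_list[of i ns] by (simp add: exponents_def sum_list_update)
      then have "power_prod R zs ?ns \<in> Idl (?M n)"
        using genideal_self[OF power_prod_in_carrier[OF zs]] by blast
      moreover have "zs ! i \<in> Idl (set zs)" using i ns mem_Idl_set[OF zs] by simp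
      ultimately show "x \<in> ideal_prod R (Idl (?M n)) (Idl (set zs))"
        using ideal_prod.prod by metis
    qed
  qed
  then show ?case using Suc.IH by simp
qed

lemma ideal_pow_subset_succ_powers:
  assumes zs: "set zs \<subseteq> carrier R" and "\<alpha> \<in> exponents (length zs) n" "n < k"
  shows "ideal_pow R (Idl (set zs)) k \<subseteq> Idl (set (succ_powers R zs \<alpha>))"
  unfolding ideal_pow_power_prod[OF zs]
  using assms by (intro genideal_minimal Idl_ideal succ_powers_closed)
    (auto simp: exponents_def intro!: power_prod_mem_succ_powers)

lemma power_prod_pow:
  assumes "set zs \<subseteq> carrier R"
  shows "power_prod R (map (\<lambda>z. z [^] (q::nat)) zs) ns = power_prod R zs ns [^] q"
  using assms
proof (induction zs arbitrary: ns)
  case (Cons z zs)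
  have "(z [^] q) [^] n = (z [^] n) [^] q" for n :: nat
    using Cons.prems by (simp add: nat_pow_pow mult.commute)
  then show ?case using Cons by (simp add: nat_pow_distrib)
qed simp

lemma param_list_pow:
  assumes "param_list zs"
  shows "param_list (map (\<lambda>z. z [^] (q::nat)) zs)"
proof (rule param_list_transfer[OF assms])
  show c: "set (map (\<lambda>z. z [^] q) zs) \<subseteq> carrier R" using param_list_carrier[OF assms] by auto
  show "\<exists>n::nat. z [^] n \<in> Idl (set (map (\<lambda>z. z [^] q) zs))" if "z \<in> set zs" for z
    using mem_Idl_set[OF c, of "z [^] q"] that by auto
qed simp

end

section \<open>Length as a supremum over chains of ideals\<close>

definition ideal_chain :: "('a, 'b) ring_scheme \<Rightarrow> 'a set \<Rightarrow> 'a set \<Rightarrow> (nat \<Rightarrow> 'a set) \<Rightarrow> nat \<Rightarrow> bool" where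
  "ideal_chain R J K N n \<longleftrightarrow> (\<forall>i\<le>n. ideal (N i) R \<and> K \<subseteq> N i \<and> N i \<subseteq> J)"

definition ideal_length :: "('a, 'b) ring_scheme \<Rightarrow> 'a set \<Rightarrow> 'a set \<Rightarrow> enat" where
  "ideal_length R J K = Sup {enat n | n. \<exists>N. ideal_chain R J K N n \<and> (\<forall>i<n. N i \<subset> N (Suc i))}"

lemma ideal_length_upper:
  "\<lbrakk>ideal_chain R J K N n; \<And>i. i < n \<Longrightarrow> N i \<subset> N (Suc i)\<rbrakk> \<Longrightarrow> enat n \<le> ideal_length R J K"
  unfolding ideal_length_def by (rule Sup_upper) blast

lemma ideal_length_least:
  "(\<And>N n. \<lbrakk>ideal_chain R J K N n; \<And>i. i < n \<Longrightarrow> N i \<subset> N (Suc i)\<rbrakk> \<Longrightarrow> enat n \<le> x)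
    \<Longrightarrow> ideal_length R J K \<le> x"
  unfolding ideal_length_def by (rule Sup_least) blast

lemma ideal_length_map:
  assumes "\<And>N. \<lbrakk>ideal N R; K \<subseteq> N; N \<subseteq> J\<rbrakk> \<Longrightarrow> ideal (\<phi> N) R \<and> K' \<subseteq> \<phi> N \<and> \<phi> N \<subseteq> J'"
    and "\<And>N N'. \<lbrakk>ideal N R; K \<subseteq> N; ideal N' R; N' \<subseteq> J; N \<subset> N'\<rbrakk> \<Longrightarrow> \<phi> N \<subset> \<phi> N'"
  shows "ideal_length R J K \<le> ideal_length R J' K'"
proof (rule ideal_length_least)
  fix N n assume N: "ideal_chain R J K N n" "\<And>i. i < n \<Longrightarrow> N i \<subset> N (Suc i)"
  show "enat n \<le> ideal_length R J' K'"
  proof (rule ideal_length_upper[of _ _ _ "\<lambda>i. \<phi> (N i)"])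
    show "ideal_chain R J' K' (\<lambda>i. \<phi> (N i)) n"
      using N(1) assms(1) unfolding ideal_chain_def by simp
    fix i assume i: "i < n"
    show "\<phi> (N i) \<subset> \<phi> (N (Suc i))"
      using N(1) N(2)[OF i] i unfolding ideal_chain_def by (intro assms(2)) auto
  qed
qed

lemma refine_weak_chain:
  assumes "ideal_chain R J K A n" "\<And>i. i < n \<Longrightarrow> A i \<subseteq> A (Suc i)"
  shows "\<exists>N. ideal_chain R J K N (card {i. i < n \<and> A i \<noteq> A (Suc i)})
      \<and> (\<forall>i<card {i. i < n \<and> A i \<noteq> A (Suc i)}. N i \<subset> N (Suc i))
      \<and> N (card {i. i < n \<and> A i \<noteq> A (Suc i)}) = A n"
  using assms
proof (induction n)
  case 0
  then show ?case by (intro exI[of _ A]) auto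
next
  case (Suc n)
  let ?c = "\<lambda>n. card {i. i < n \<and> A i \<noteq> A (Suc i)}"
  from Suc obtain N where N: "ideal_chain R J K N (?c n)" "\<forall>i<?c n. N i \<subset> N (Suc i)" "N (?c n) = A n"
    by (auto simp: ideal_chain_def)
  show ?case
  proof (cases "A n = A (Suc n)")
    case True
    then have "{i. i < Suc n \<and> A i \<noteq> A (Suc i)} = {i. i < n \<and> A i \<noteq> A (Suc i)}"
      by (auto simp: less_Suc_eq)
    then show ?thesis using N True by auto
  next
    case False
    then have "{i. i < Suc n \<and> A i \<noteq> A (Suc i)} = insert n {i. i < n \<and> A i \<noteq> A (Suc i)}"
      by (auto simp: less_Suc_eq)
    then have c: "?c (Suc n) = Suc (?c n)" by simp
    have "A n \<subset> A (Suc n)" using False Suc.prems(2)[of n] by auto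
    then show ?thesis
      unfolding c using N Suc.prems(1)
      by (intro exI[of _ "N(Suc (?c n) := A (Suc n))"]) (auto simp: ideal_chain_def less_Suc_eq)
  qed
qed

lemma weak_chain_length:
  assumes "ideal_chain R J K A n" "\<And>i. i < n \<Longrightarrow> A i \<subseteq> A (Suc i)"
  shows "enat (card {i. i < n \<and> A i \<noteq> A (Suc i)}) \<le> ideal_length R J K"
proof -
  obtain N where N: "ideal_chain R J K N (card {i. i < n \<and> A i \<noteq> A (Suc i)})"
    "\<forall>i<card {i. i < n \<and> A i \<noteq> A (Suc i)}. N i \<subset> N (Suc i)"
    using refine_weak_chain[OF assms] by blast
  then show ?thesis by (intro ideal_length_upper[OF N(1)]) simp
qed

lemma ideal_length_refl [simp]: "ideal_length R J J = 0"
proof -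
  have "ideal_length R J J \<le> enat 0"
  proof (rule ideal_length_least)
    fix N n assume N: "ideal_chain R J J N n" "\<And>i. i < n \<Longrightarrow> N i \<subset> N (Suc i)"
    have "n = 0"
    proof (rule ccontr)
      assume "n \<noteq> 0"
      then have "0 < n" by simp
      then have "N 0 \<subset> N 1" "J \<subseteq> N 0" "N 1 \<subseteq> J"
        using N(1) N(2)[of 0] unfolding ideal_chain_def by auto
      then show False by blast
    qed
    then show "enat n \<le> enat 0" by simp
  qed
  then show ?thesis by (simp add: zero_enat_def[symmetric])
qed

lemma ideal_length_pos:
  assumes "ideal J R" "ideal K R" "K \<subset> J"
  shows "1 \<le> ideal_length R J K"
proof -
  have "enat 1 \<le> ideal_length R J K"
    using assms by (intro ideal_length_upper[of _ _ _ "\<lambda>i. if i = 0 then K else J"])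
      (auto simp: ideal_chain_def)
  then show ?thesis by (simp add: one_enat_def)
qed

context cring
begin

lemma ideal_Int: "\<lbrakk>ideal A R; ideal B R\<rbrakk> \<Longrightarrow> ideal (A \<inter> B) R"
  by (rule i_intersect)

lemma mem_set_add: "x \<in> set_add R A B \<longleftrightarrow> (\<exists>a\<in>A. \<exists>b\<in>B. x = a \<oplus> b)"
  by (auto simp: set_add_def')

lemma set_add_upper:
  assumes "ideal A R" "ideal B R"
  shows "A \<subseteq> set_add R A B" "B \<subseteq> set_add R A B"
proof -
  show "A \<subseteq> set_add R A B"
  proof
    fix x assume x: "x \<in> A"
    then have "x = x \<oplus> \<zero>" using ideal.Icarr[OF assms(1)] by simp
    then show "x \<in> set_add R A B" unfolding mem_set_add using x ideal_zero[OF assms(2)] by blast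
  qed
  show "B \<subseteq> set_add R A B"
  proof
    fix x assume x: "x \<in> B"
    then have "x = \<zero> \<oplus> x" using ideal.Icarr[OF assms(2)] by simp
    then show "x \<in> set_add R A B" unfolding mem_set_add using x ideal_zero[OF assms(1)] by blast
  qed
qed

lemma set_add_least: "\<lbrakk>ideal C R; A \<subseteq> C; B \<subseteq> C\<rbrakk> \<Longrightarrow> set_add R A B \<subseteq> C"
  by (auto simp: mem_set_add intro!: ideal_add)

lemma modular_eq:
  assumes I: "ideal N R" "ideal N' R" "ideal M R" and "N \<subseteq> N'"
    and "N \<inter> M = N' \<inter> M" "set_add R N M = set_add R N' M"
  shows "N = N'"
proof
  show "N' \<subseteq> N"
  proof
    fix x assume x: "x \<in> N'"
    then have "x \<in> set_add R N M" using set_add_upper[OF I(2,3)] assms(6) by blast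
    then obtain n m where nm: "n \<in> N" "m \<in> M" "x = n \<oplus> m" by (auto simp: mem_set_add)
    have c: "n \<in> carrier R" "m \<in> carrier R" using nm ideal.Icarr[OF I(1)] ideal.Icarr[OF I(3)] by auto
    have "m = x \<ominus> n" unfolding nm(3) using c by algebra
    then have "m \<in> N'" using ideal_diff[OF I(2) x, of n] nm(1) assms(4) by blast
    then have "m \<in> N" using nm(2) assms(5) by blast
    then show "x \<in> N" using nm ideal_add[OF I(1)] by simp
  qed
qed (rule assms(4))

lemma ideal_length_add:
  assumes I: "ideal K R" "ideal M R" "ideal J R" and sub: "K \<subseteq> M" "M \<subseteq> J"
  shows "ideal_length R J K = ideal_length R J M + ideal_length R M K"
proof (rule antisym)
  show "ideal_length R J K \<le> ideal_length R J M + ideal_length R M K"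
  proof (rule ideal_length_least)
    fix N n assume N: "ideal_chain R J K N n" "\<And>i. i < n \<Longrightarrow> N i \<subset> N (Suc i)"
    let ?A = "\<lambda>i. N i \<inter> M" and ?B = "\<lambda>i. set_add R (N i) M"
    let ?a = "{i. i < n \<and> ?A i \<noteq> ?A (Suc i)}" and ?b = "{i. i < n \<and> ?B i \<noteq> ?B (Suc i)}"
    have a: "enat (card ?a) \<le> ideal_length R M K"
    proof (rule weak_chain_length)
      show "ideal_chain R M K ?A n"
        using N(1) I sub by (auto simp: ideal_chain_def intro: ideal_Int)
      show "?A i \<subseteq> ?A (Suc i)" if "i < n" for i
        using N(2)[OF that] by auto
    qed
    have b: "enat (card ?b) \<le> ideal_length R J M"
    proof (rule weak_chain_length)
      have "ideal (?B i) R \<and> M \<subseteq> ?B i \<and> ?B i \<subseteq> J" if "i \<le> n" for i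
        using N(1) that I sub set_add_upper[of "N i" M] set_add_least[of J "N i" M]
        by (auto simp: ideal_chain_def intro!: add_ideals)
      then show "ideal_chain R J M ?B n" by (simp add: ideal_chain_def)
      show "?B i \<subseteq> ?B (Suc i)" if "i < n" for i
        using N(2)[OF that] by (auto simp: mem_set_add) blast
    qed
    have "n \<le> card ?b + card ?a"
    proof -
      have "i \<in> ?a \<union> ?b" if i: "i < n" for i
      proof (rule ccontr)
        assume "i \<notin> ?a \<union> ?b"
        with i have eq: "?A i = ?A (Suc i)" "?B i = ?B (Suc i)" by simp_all
        have "ideal (N i) R" "ideal (N (Suc i)) R" "N i \<subseteq> N (Suc i)"
          using N(1) N(2)[OF i] i by (auto simp: ideal_chain_def)
        from modular_eq[OF this(1,2) I(2) this(3) eq] have "N i = N (Suc i)" .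
        then show False using N(2)[OF i] by blast
      qed
      then have "{..<n} \<subseteq> ?a \<union> ?b" by blast
      then have "card {..<n} \<le> card (?a \<union> ?b)" by (intro card_mono) auto
      also have "\<dots> \<le> card ?a + card ?b" by (rule card_Un_le)
      finally show ?thesis by simp
    qed
    then have "enat n \<le> enat (card ?b) + enat (card ?a)" by simp
    also have "\<dots> \<le> ideal_length R J M + ideal_length R M K" by (rule add_mono[OF b a])
    finally show "enat n \<le> ideal_length R J M + ideal_length R M K" .
  qed
  show "ideal_length R J M + ideal_length R M K \<le> ideal_length R J K"
  proof -
    have step: "enat m + enat n \<le> ideal_length R J K"
      if P: "ideal_chain R J M P n" "\<And>i. i < n \<Longrightarrow> P i \<subset> P (Suc i)"
        and Q: "ideal_chain R M K Q m" "\<And>i. i < m \<Longrightarrow> Q i \<subset> Q (Suc i)" for P Q n m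
    proof -
      let ?N = "\<lambda>i. if i < m then Q i else P (i - m)"
      have "enat (m + n) \<le> ideal_length R J K"
      proof (rule ideal_length_upper)
        have "ideal (?N i) R \<and> K \<subseteq> ?N i \<and> ?N i \<subseteq> J" if "i \<le> m + n" for i
        proof (cases "i < m")
          case True
          then have "ideal (Q i) R" "K \<subseteq> Q i" "Q i \<subseteq> M" using Q(1) by (auto simp: ideal_chain_def)
          then show ?thesis using sub True by auto
        next
          case False
          then have "i - m \<le> n" using that by auto
          then show ?thesis using P(1) sub False by (auto simp: ideal_chain_def)
        qed
        then show "ideal_chain R J K ?N (m + n)" by (simp add: ideal_chain_def)
        show "?N i \<subset> ?N (Suc i)" if i: "i < m + n" for i
        proof -
          consider "Suc i < m" | "Suc i = m" | "m \<le> i" by linarith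
          then show ?thesis
          proof cases
            case 2
            have "Q i \<subset> Q m" using Q(2)[of i] 2 by simp
            moreover have "Q m \<subseteq> M" "M \<subseteq> P 0" using Q(1) P(1) by (auto simp: ideal_chain_def)
            ultimately show ?thesis using 2 by auto
          next
            case 3
            then show ?thesis using P(2)[of "i - m"] i by (auto simp: Suc_diff_le)
          qed (use Q(2) in auto)
        qed
      qed
      then show ?thesis by simp
    qed
    define s where "s = ideal_length R J K"
    have 1: "enat m + ideal_length R J M \<le> s"
      if Q: "ideal_chain R M K Q m" "\<And>i. i < m \<Longrightarrow> Q i \<subset> Q (Suc i)" for Q m
    proof (cases s)
      case (enat k)
      have "m \<le> k" using step[OF _ _ Q, of "\<lambda>_. J" 0] I sub enat
        by (simp add: ideal_chain_def s_def)
      have "ideal_length R J M \<le> enat (k - m)"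
      proof (rule ideal_length_least)
        fix N n assume "ideal_chain R J M N n" "\<And>i. i < n \<Longrightarrow> N i \<subset> N (Suc i)"
        from step[OF this Q] show "enat n \<le> enat (k - m)" using enat by (simp add: s_def)
      qed
      then show ?thesis using \<open>m \<le> k\<close> enat by (cases "ideal_length R J M") auto
    qed simp
    have "ideal_length R J M + ideal_length R M K \<le> s"
    proof (cases s)
      case (enat k)
      have "ideal_length R J M \<le> s"
        using 1[of "\<lambda>_. M" 0] I sub by (simp add: ideal_chain_def zero_enat_def[symmetric])
      then obtain l where l: "ideal_length R J M = enat l" "l \<le> k"
        using enat by (cases "ideal_length R J M") auto
      have "ideal_length R M K \<le> enat (k - l)"
      proof (rule ideal_length_least)
        fix N n assume "ideal_chain R M K N n" "\<And>i. i < n \<Longrightarrow> N i \<subset> N (Suc i)"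
        from 1[OF this] show "enat n \<le> enat (k - l)" using enat l by simp
      qed
      then show ?thesis using l enat by (cases "ideal_length R M K") auto
    qed simp
    then show ?thesis by (simp add: s_def)
  qed
qed

definition cyclic_add :: "'a set \<Rightarrow> 'a \<Rightarrow> 'a set \<Rightarrow> 'a set" where
  "cyclic_add K u W = {k \<otimes> u \<oplus> x | k x. k \<in> K \<and> x \<in> W}"

lemma cyclic_add_ideal:
  assumes K: "ideal K R" and W: "ideal W R" and u: "u \<in> carrier R"
  shows "ideal (cyclic_add K u W) R"
proof (rule idealI_cring)
  note c = ideal.Icarr[OF K] ideal.Icarr[OF W]
  show "cyclic_add K u W \<subseteq> carrier R" using c u by (auto simp: cyclic_add_def)
  show "\<zero> \<in> cyclic_add K u W"
    using ideal_zero[OF K] ideal_zero[OF W] u by (force simp: cyclic_add_def)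
  fix x y assume "x \<in> cyclic_add K u W" "y \<in> cyclic_add K u W"
  then obtain k l w v where kl: "k \<in> K" "l \<in> K" "w \<in> W" "v \<in> W" "x = k \<otimes> u \<oplus> w" "y = l \<otimes> u \<oplus> v"
    by (auto simp: cyclic_add_def)
  have cc: "k \<in> carrier R" "l \<in> carrier R" "w \<in> carrier R" "v \<in> carrier R" using kl c by auto
  have "x \<oplus> y = (k \<oplus> l) \<otimes> u \<oplus> (w \<oplus> v)" unfolding kl using cc u by algebra
  then show "x \<oplus> y \<in> cyclic_add K u W"
    using ideal_add[OF K kl(1,2)] ideal_add[OF W kl(3,4)] by (auto simp: cyclic_add_def)
next
  note c = ideal.Icarr[OF K] ideal.Icarr[OF W]
  fix a x assume a: "a \<in> carrier R" and "x \<in> cyclic_add K u W"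
  then obtain k w where kl: "k \<in> K" "w \<in> W" "x = k \<otimes> u \<oplus> w" by (auto simp: cyclic_add_def)
  have cc: "k \<in> carrier R" "w \<in> carrier R" using kl c by auto
  have "a \<otimes> x = (a \<otimes> k) \<otimes> u \<oplus> (a \<otimes> w)" unfolding kl using cc a u by algebra
  then show "a \<otimes> x \<in> cyclic_add K u W"
    using ideal_mult[OF K kl(1) a] ideal_mult[OF W kl(2) a] by (auto simp: cyclic_add_def)
qed

lemma cyclic_add_upper:
  assumes K: "ideal K R" and W: "ideal W R" and u: "u \<in> carrier R"
  shows "W \<subseteq> cyclic_add K u W" "\<And>k. k \<in> K \<Longrightarrow> k \<otimes> u \<in> cyclic_add K u W"
proof -
  show "W \<subseteq> cyclic_add K u W"
  proof
    fix x assume x: "x \<in> W"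
    then have "x = \<zero> \<otimes> u \<oplus> x" using u ideal.Icarr[OF W] by simp
    then show "x \<in> cyclic_add K u W" using x ideal_zero[OF K] unfolding cyclic_add_def by blast
  qed
  show "k \<otimes> u \<in> cyclic_add K u W" if k: "k \<in> K" for k
  proof -
    have "k \<otimes> u = k \<otimes> u \<oplus> \<zero>" using u k ideal.Icarr[OF K] by simp
    then show ?thesis using k ideal_zero[OF W] unfolding cyclic_add_def by blast
  qed
qed

lemma colon_ideal:
  assumes K: "ideal K R" and W: "ideal W R" and u: "u \<in> carrier R"
  shows "ideal {k \<in> K. k \<otimes> u \<in> W} R"
proof (rule idealI_cring)
  note c = ideal.Icarr[OF K]
  show "{k \<in> K. k \<otimes> u \<in> W} \<subseteq> carrier R" using c by auto
  show "\<zero> \<in> {k \<in> K. k \<otimes> u \<in> W}" using ideal_zero[OF K] ideal_zero[OF W] u by simp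
  show "x \<oplus> y \<in> {k \<in> K. k \<otimes> u \<in> W}" if "x \<in> {k \<in> K. k \<otimes> u \<in> W}" "y \<in> {k \<in> K. k \<otimes> u \<in> W}" for x y
    using that c u by (auto simp: l_distr intro: ideal_add[OF K] ideal_add[OF W])
  show "a \<otimes> x \<in> {k \<in> K. k \<otimes> u \<in> W}" if "a \<in> carrier R" "x \<in> {k \<in> K. k \<otimes> u \<in> W}" for a x
    using that c u by (auto simp: m_assoc intro: ideal_mult[OF K] ideal_mult[OF W])
qed

lemma ideal_length_cyclic_add:
  assumes K: "ideal K R" and W: "ideal W R" and u: "u \<in> carrier R"
  shows "ideal_length R (cyclic_add K u W) W = ideal_length R K {k \<in> K. k \<otimes> u \<in> W}"
proof (rule antisym)
  let ?Z = "{k \<in> K. k \<otimes> u \<in> W}"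
  show "ideal_length R (cyclic_add K u W) W \<le> ideal_length R K ?Z"
  proof (rule ideal_length_map[where \<phi> = "\<lambda>N. {k \<in> K. k \<otimes> u \<in> N}"])
    fix N assume "ideal N R" "W \<subseteq> N"
    then show "ideal {k \<in> K. k \<otimes> u \<in> N} R \<and> ?Z \<subseteq> {k \<in> K. k \<otimes> u \<in> N} \<and> {k \<in> K. k \<otimes> u \<in> N} \<subseteq> K"
      using colon_ideal[OF K _ u] by auto
  next
    fix N N' assume N: "ideal N R" "W \<subseteq> N" "ideal N' R" "N' \<subseteq> cyclic_add K u W" "N \<subset> N'"
    then obtain y where y: "y \<in> N'" "y \<notin> N" by blast
    then obtain k x where k: "k \<in> K" "x \<in> W" "y = k \<otimes> u \<oplus> x"
      using N(4) by (auto simp: cyclic_add_def)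
    have ku: "k \<otimes> u \<in> carrier R" using ideal.Icarr[OF K k(1)] u by simp
    have "k \<otimes> u \<notin> N" using y k N(2) ideal_add[OF N(1), of "k \<otimes> u" x] by auto
    moreover have "k \<otimes> u \<in> N'"
      using ideal_add_cancel[OF N(3) _ _ ku, of x] y(1) k(2,3) N(2,5) by auto
    ultimately show "{k \<in> K. k \<otimes> u \<in> N} \<subset> {k \<in> K. k \<otimes> u \<in> N'}" using N(5) k(1) by blast
  qed
  show "ideal_length R K ?Z \<le> ideal_length R (cyclic_add K u W) W"
  proof (rule ideal_length_map[where \<phi> = "\<lambda>P. cyclic_add P u W"])
    fix P assume "ideal P R" "?Z \<subseteq> P" "P \<subseteq> K"
    then show "ideal (cyclic_add P u W) R \<and> W \<subseteq> cyclic_add P u W \<and> cyclic_add P u W \<subseteq> cyclic_add K u W"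
      using cyclic_add_ideal[OF _ W u] cyclic_add_upper(1)[OF _ W u] by (auto simp: cyclic_add_def)
  next
    fix P P' assume P: "ideal P R" "?Z \<subseteq> P" "ideal P' R" "P' \<subseteq> K" "P \<subset> P'"
    then obtain k where k: "k \<in> P'" "k \<notin> P" by blast
    have "k \<otimes> u \<notin> cyclic_add P u W"
    proof
      assume "k \<otimes> u \<in> cyclic_add P u W"
      then obtain q x where q: "q \<in> P" "x \<in> W" "k \<otimes> u = q \<otimes> u \<oplus> x" by (auto simp: cyclic_add_def)
      have c: "k \<in> carrier R" "q \<in> carrier R" "x \<in> carrier R"
        using k q ideal.Icarr[OF P(3)] ideal.Icarr[OF P(1)] ideal.Icarr[OF W] by auto
      have "(k \<ominus> q) \<otimes> u = k \<otimes> u \<ominus> q \<otimes> u" using c u by algebra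
      also have "\<dots> = x" unfolding q(3) using c u by algebra
      finally have "(k \<ominus> q) \<otimes> u \<in> W" using q(2) by simp
      moreover have "k \<ominus> q \<in> K" using k q P ideal_diff[OF P(3), of k q] by blast
      ultimately have "k \<ominus> q \<in> P" using P(2) by blast
      then have "(k \<ominus> q) \<oplus> q \<in> P" using ideal_add[OF P(1)] q(1) by blast
      moreover have "(k \<ominus> q) \<oplus> q = k" using c by algebra
      ultimately show False using k(2) by simp
    qed
    moreover have "k \<otimes> u \<in> cyclic_add P' u W" using cyclic_add_upper(2)[OF P(3) W u k(1)] .
    moreover have "cyclic_add P u W \<subseteq> cyclic_add P' u W" using P(5) by (auto simp: cyclic_add_def)
    ultimately show "cyclic_add P u W \<subset> cyclic_add P' u W" by blast
  qed
qed

lemma ideal_length_second_iso: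
  assumes A: "ideal A R" and B: "ideal B R"
  shows "ideal_length R (set_add R A B) B = ideal_length R A (A \<inter> B)"
proof -
  have "set_add R A B = cyclic_add A \<one> B"
    using ideal.Icarr[OF A] by (auto simp: set_add_def' cyclic_add_def) force+
  moreover have "A \<inter> B = {k \<in> A. k \<otimes> \<one> \<in> B}" using ideal.Icarr[OF A] by auto
  ultimately show ?thesis using ideal_length_cyclic_add[OF A B one_closed] by simp
qed

definition span_over :: "'a set \<Rightarrow> ('i \<Rightarrow> 'a) \<Rightarrow> 'i set \<Rightarrow> 'a set \<Rightarrow> 'a set" where
  "span_over K u B W = Idl ({k \<otimes> u b | k b. k \<in> K \<and> b \<in> B} \<union> W)"

lemma span_over_ideal:
  assumes "ideal K R" "ideal W R" "\<And>b. b \<in> B \<Longrightarrow> u b \<in> carrier R"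
  shows "ideal (span_over K u B W) R"
    and "{k \<otimes> u b | k b. k \<in> K \<and> b \<in> B} \<union> W \<subseteq> span_over K u B W"
proof -
  have c: "{k \<otimes> u b | k b. k \<in> K \<and> b \<in> B} \<union> W \<subseteq> carrier R"
    using assms ideal.Icarr[OF assms(1)] ideal.Icarr[OF assms(2)] by auto
  show "ideal (span_over K u B W) R" unfolding span_over_def by (rule genideal_ideal[OF c])
  show "{k \<otimes> u b | k b. k \<in> K \<and> b \<in> B} \<union> W \<subseteq> span_over K u B W"
    unfolding span_over_def by (rule genideal_self[OF c])
qed

lemma span_over_least:
  assumes "ideal C R" "\<And>k b. \<lbrakk>k \<in> K; b \<in> B\<rbrakk> \<Longrightarrow> k \<otimes> u b \<in> C" "W \<subseteq> C"
  shows "span_over K u B W \<subseteq> C"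
  unfolding span_over_def using assms by (intro genideal_minimal) auto

lemma span_over_insert:
  assumes K: "ideal K R" and W: "ideal W R" and u: "\<And>b. b \<in> insert a B \<Longrightarrow> u b \<in> carrier R"
  shows "span_over K u (insert a B) W = cyclic_add K (u a) (span_over K u B W)"
proof -
  have ua: "u a \<in> carrier R" and uB: "\<And>b. b \<in> B \<Longrightarrow> u b \<in> carrier R" using u by auto
  note S = span_over_ideal[where u = u and B = B, OF K W uB]
  note S' = span_over_ideal[where u = u and B = "insert a B", OF K W u]
  show ?thesis
  proof
    show "span_over K u (insert a B) W \<subseteq> cyclic_add K (u a) (span_over K u B W)"
    proof (rule span_over_least[OF cyclic_add_ideal[OF K S(1) ua]])
      show "k \<otimes> u b \<in> cyclic_add K (u a) (span_over K u B W)" if "k \<in> K" "b \<in> insert a B" for k b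
      proof (cases "b = a")
        case True
        then show ?thesis using cyclic_add_upper(2)[OF K S(1) ua that(1)] by simp
      next
        case False
        then have "k \<otimes> u b \<in> span_over K u B W" using that S(2) by auto
        then show ?thesis using cyclic_add_upper(1)[OF K S(1) ua] by (rule rev_subsetD)
      qed
      show "W \<subseteq> cyclic_add K (u a) (span_over K u B W)"
        using S(2) cyclic_add_upper(1)[OF K S(1) ua] by auto
    qed
    have "span_over K u B W \<subseteq> span_over K u (insert a B) W"
      using S'(2) by (intro span_over_least S'(1)) auto
    then show "cyclic_add K (u a) (span_over K u B W) \<subseteq> span_over K u (insert a B) W"
    proof (intro subsetI)
      fix y assume "y \<in> cyclic_add K (u a) (span_over K u B W)"
        and sub: "span_over K u B W \<subseteq> span_over K u (insert a B) W"
      then obtain k x where k: "k \<in> K" "x \<in> span_over K u (insert a B) W" "y = k \<otimes> u a \<oplus> x"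
        by (auto simp: cyclic_add_def)
      moreover have "k \<otimes> u a \<in> span_over K u (insert a B) W" using S'(2) k(1) by blast
      ultimately show "y \<in> span_over K u (insert a B) W" using ideal_add[OF S'(1)] by blast
    qed
  qed
qed

text \<open>The ideals \<open>Q b\<close> witness that the elements \<open>u b\<close> are independent over \<open>R / I\<close> modulo \<open>W\<close>.\<close>

lemma ideal_length_span_over:
  assumes K: "ideal K R" and W: "ideal W R" and "finite B" and u: "\<And>b. b \<in> B \<Longrightarrow> u b \<in> carrier R"
    and I: "I \<subseteq> K" "\<And>k b. \<lbrakk>k \<in> I; b \<in> B\<rbrakk> \<Longrightarrow> k \<otimes> u b \<in> W"
    and Q: "\<And>b. b \<in> B \<Longrightarrow> ideal (Q b) R" "\<And>b. b \<in> B \<Longrightarrow> W \<subseteq> Q b"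
      "\<And>b c. \<lbrakk>b \<in> B; c \<in> B; c \<noteq> b\<rbrakk> \<Longrightarrow> u c \<in> Q b"
      "\<And>b k. \<lbrakk>b \<in> B; k \<in> carrier R; k \<otimes> u b \<in> Q b\<rbrakk> \<Longrightarrow> k \<in> I"
  shows "ideal_length R (span_over K u B W) W = enat (card B) * ideal_length R K I"
  using \<open>finite B\<close> u I(2) Q
proof (induction B rule: finite_induct)
  case empty
  have "span_over K u {} W = W"
    using genideal_minimal[OF W] genideal_self[OF ideal_subset[OF W]] by (auto simp: span_over_def)
  then show ?case by (simp add: zero_enat_def[symmetric])
next
  case (insert a B)
  have ua: "u a \<in> carrier R" and uB: "\<And>b. b \<in> B \<Longrightarrow> u b \<in> carrier R" using insert.prems by auto
  let ?S = "span_over K u B W"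
  note S = span_over_ideal[where u = u and B = B, OF K W uB]
  have SQ: "?S \<subseteq> Q a"
  proof (rule span_over_least)
    fix k b assume kb: "k \<in> K" "b \<in> B"
    then have "u b \<in> Q a" using insert.hyps(2) by (intro insert.prems(5)) auto
    then show "k \<otimes> u b \<in> Q a"
      using insert.prems(3) ideal.Icarr[OF K kb(1)] by (intro ideal_mult) auto
  qed (use insert.prems in auto)
  have "{k \<in> K. k \<otimes> u a \<in> ?S} = I"
    using I(1) insert.prems(2)[of _ a] insert.prems(6)[of a] S(2) SQ ideal.Icarr[OF K] by blast
  then have "ideal_length R (cyclic_add K (u a) ?S) ?S = ideal_length R K I"
    using ideal_length_cyclic_add[OF K S(1) ua] by simp
  moreover have "ideal_length R ?S W = enat (card B) * ideal_length R K I"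
  proof (rule insert.IH)
    show "k \<in> I" if "b \<in> B" "k \<in> carrier R" "k \<otimes> u b \<in> Q b" for b k
      using insert.prems(6)[of b k] that by simp
  qed (use insert.prems in auto)
  moreover have "ideal_length R (cyclic_add K (u a) ?S) W
      = ideal_length R (cyclic_add K (u a) ?S) ?S + ideal_length R ?S W"
    using S(2) by (intro ideal_length_add W S(1) cyclic_add_ideal K ua cyclic_add_upper) auto
  ultimately have "ideal_length R (cyclic_add K (u a) ?S) W
     = ideal_length R K I + enat (card B) * ideal_length R K I" by simp
  also have "\<dots> = enat (card (insert a B)) * ideal_length R K I"
    using insert.hyps by (simp add: distrib_right one_enat_def[symmetric] eSuc_plus_1 eSuc_enat[symmetric] add.commute)
  finally show ?case using span_over_insert[where u = u and B = B and a = a, OF K W insert.prems(1)] by simp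
qed

lemma ideal_length_finite:
  assumes m: "maximalideal m R" and "finite A" "A \<subseteq> carrier R" "ideal K R"
    and "B \<subseteq> K" "m \<subseteq> Idl (A \<union> B)" "\<And>a. a \<in> A \<Longrightarrow> \<exists>n::nat. a [^] n \<in> K"
  shows "ideal_length R (carrier R) K < \<infinity>"
  using assms(2-)
proof (induction A arbitrary: B K rule: finite_induct)
  case empty
  have mK: "m \<subseteq> K" using genideal_minimal[OF empty.prems(2,3)] empty.prems(4) by auto
  have "ideal_length R (carrier R) K \<le> enat 1"
  proof (rule ideal_length_least)
    fix N n assume N: "ideal_chain R (carrier R) K N n" "\<And>i. i < n \<Longrightarrow> N i \<subset> N (Suc i)"
    show "enat n \<le> enat 1"
    proof (rule ccontr)
      assume "\<not> ?thesis"
      then have n: "1 < n" by simp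
      have c: "ideal (N i) R" "K \<subseteq> N i" "N i \<subseteq> carrier R" if "i \<le> 2" for i
        using N(1) n that by (simp_all add: ideal_chain_def)
      have s: "N 0 \<subset> N 1" "N 1 \<subset> N 2" using N(2)[of 0] N(2)[of 1] n by (simp_all add: numeral_2_eq_2)
      have "m \<subseteq> N 0" using c(2)[of 0] mK by simp
      moreover have "N 1 = m \<or> N 1 = carrier R"
        using s(1) \<open>m \<subseteq> N 0\<close> by (intro maximalideal.I_maximal[OF m]) (auto simp: c)
      ultimately show False using s c(3)[of 2] by auto
    qed
  qed
  then show ?case by (meson enat_ord_code(4) order_le_less_trans)
next
  case (insert a A)
  have a: "a \<in> carrier R" "A \<subseteq> carrier R" using insert.prems by auto
  obtain n :: nat where "a [^] n \<in> K" using insert.prems(5)[of a] by auto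
  then show ?case using insert.prems(2-5)
  proof (induction n arbitrary: K)
    case 0
    then have "K = carrier R" using ideal.one_imp_carrier[of K R] by simp
    then show ?case by simp
  next
    case (Suc n)
    let ?K1 = "cyclic_add (carrier R) a K" and ?K2 = "{k \<in> carrier R. k \<otimes> a \<in> K}"
    note K = \<open>ideal K R\<close>
    have K1: "ideal ?K1 R" by (rule cyclic_add_ideal[OF oneideal K a(1)])
    have K2: "ideal ?K2 R" by (rule colon_ideal[OF oneideal K a(1)])
    have KK1: "K \<subseteq> ?K1" "a \<in> ?K1"
      using cyclic_add_upper[OF oneideal K a(1)] a one_closed by (auto dest: spec[of _ \<one>]) (metis l_one one_closed)
    have KK2: "K \<subseteq> ?K2" using ideal.I_r_closed[OF K _ a(1)] ideal.Icarr[OF K] by auto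
    have "ideal_length R (carrier R) ?K1 < \<infinity>"
    proof (rule insert.IH[of ?K1 "insert a B"])
      show "\<exists>n::nat. b [^] n \<in> ?K1" if "b \<in> A" for b
        using Suc.prems(5)[of b] that KK1 by blast
    qed (use a K1 KK1 Suc.prems in auto)
    moreover have "ideal_length R (carrier R) ?K2 < \<infinity>"
    proof (rule Suc.IH)
      show "a [^] n \<in> ?K2" using Suc.prems(1) a by simp
      show "\<exists>n::nat. b [^] n \<in> ?K2" if "b \<in> insert a A" for b
        using Suc.prems(5)[OF that] KK2 by blast
    qed (use K2 KK2 Suc.prems in auto)
    moreover have "ideal_length R (carrier R) K = ideal_length R (carrier R) ?K1 + ideal_length R ?K1 K"
      using KK1 ideal_subset[OF K1] by (intro ideal_length_add K K1 oneideal)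
    moreover have "ideal_length R ?K1 K = ideal_length R (carrier R) ?K2"
      by (rule ideal_length_cyclic_add[OF oneideal K a(1)])
    ultimately show ?case by auto
  qed
qed

lemma module_length_quotient:
  assumes K: "ideal K R" and J: "ideal J R" and KJ: "K \<subseteq> J"
  shows "module_length R (quotient_module R J K) = ideal_length R J K"
proof (rule antisym)
  let ?M = "quotient_module R J K"
  interpret K: ideal K R by (rule K)
  have Jc: "\<And>x. x \<in> J \<Longrightarrow> x \<in> carrier R" using ideal.Icarr[OF J] .
  have carr: "carrier ?M = (\<lambda>x. K +> x) ` J" and addM: "add ?M = set_add R" and zeroM: "\<zero>\<^bsub>?M\<^esub> = K"
    and smultM: "\<And>a Y. a \<odot>\<^bsub>?M\<^esub> Y = rcoset_mult R K (K +> a) Y"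
    by (auto simp: quotient_module_def)
  have K0: "K = K +> \<zero>" using a_coset_add_zero K.a_subset by simp
  have eq: "K +> x = K +> y \<longleftrightarrow> x \<ominus> y \<in> K" if "x \<in> carrier R" "y \<in> carrier R" for x y
    using quotient_eq_iff_same_a_r_cos[OF K that] by simp
  show "module_length R ?M \<le> ideal_length R J K"
    unfolding module_length_def
  proof (rule Sup_least, clarify)
    fix n N assume N: "\<forall>i\<le>n. submodule (N i) R ?M" "\<forall>i<n. N i \<subset> N (Suc i)"
    let ?f = "\<lambda>H. {x \<in> J. K +> x \<in> H}"
    have sub: "H \<subseteq> (\<lambda>x. K +> x) ` J" and id: "ideal (?f H) R" and KH: "K \<subseteq> ?f H"
      if H: "submodule H R ?M" for H
    proof -
      have H1: "subgroup H (add_monoid ?M)" using H by (rule submodule.axioms(1))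
      have sm: "\<And>a x. \<lbrakk>a \<in> carrier R; x \<in> H\<rbrakk> \<Longrightarrow> a \<odot>\<^bsub>?M\<^esub> x \<in> H" by (rule submodule.smult_closed[OF H])
      show "H \<subseteq> (\<lambda>x. K +> x) ` J" using subgroup.subset[OF H1] carr by simp
      have z: "K \<in> H" using subgroup.one_closed[OF H1] zeroM by simp
      show "K \<subseteq> ?f H"
      proof
        fix x assume x: "x \<in> K"
        then have "K +> x = K" using eq[of x \<zero>] K0 K.Icarr by (simp add: a_minus_def)
        then show "x \<in> ?f H" using x KJ z by auto
      qed
      show "ideal (?f H) R"
      proof (rule idealI_cring)
        show "\<zero> \<in> ?f H" using ideal_zero[OF J] z K0 by simp
        show "x \<oplus> y \<in> ?f H" if "x \<in> ?f H" "y \<in> ?f H" for x y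
        proof -
          have "set_add R (K +> x) (K +> y) \<in> H"
            using subgroup.m_closed[OF H1, of "K +> x" "K +> y"] that addM by simp
          then show ?thesis using that Jc K.a_rcos_sum[of x y] ideal_add[OF J] by auto
        qed
        show "a \<otimes> x \<in> ?f H" if "a \<in> carrier R" "x \<in> ?f H" for a x
          using sm[of a "K +> x"] that Jc K.rcoset_mult_add[of a x] ideal_mult[OF J] smultM by auto
      qed (use Jc in auto)
    qed
    show "enat n \<le> ideal_length R J K"
    proof (rule ideal_length_upper)
      show "ideal_chain R J K (\<lambda>i. ?f (N i)) n"
        using id KH N(1) by (auto simp: ideal_chain_def)
      show "?f (N i) \<subset> ?f (N (Suc i))" if i: "i < n" for i
      proof -
        obtain h where h: "h \<in> N (Suc i)" "h \<notin> N i" using N(2) i by blast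
        moreover obtain x where "x \<in> J" "h = K +> x" using sub[of "N (Suc i)"] N(1) i h(1) by auto
        ultimately show ?thesis using N(2) i by blast
      qed
    qed
  qed
  show "ideal_length R J K \<le> module_length R ?M"
  proof (rule ideal_length_least)
    fix N n assume N: "ideal_chain R J K N n" "\<And>i. i < n \<Longrightarrow> N i \<subset> N (Suc i)"
    let ?g = "\<lambda>N. (\<lambda>x. K +> x) ` N"
    have subm: "submodule (?g P) R ?M" if P: "ideal P R" "P \<subseteq> J" for P
    proof (intro submodule.intro submodule_axioms.intro subgroup.intro)
      show "?g P \<subseteq> carrier (add_monoid ?M)" using P carr by auto
      show "\<one>\<^bsub>add_monoid ?M\<^esub> \<in> ?g P" using zeroM K0 ideal_zero[OF P(1)] by auto
      have Pc: "\<And>x. x \<in> P \<Longrightarrow> x \<in> carrier R" using ideal.Icarr[OF P(1)] .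
      show "x \<otimes>\<^bsub>add_monoid ?M\<^esub> y \<in> ?g P" if "x \<in> ?g P" "y \<in> ?g P" for x y
        using that addM Pc K.a_rcos_sum ideal_add[OF P(1)] by auto
      show "a \<odot>\<^bsub>?M\<^esub> x \<in> ?g P" if "a \<in> carrier R" "x \<in> ?g P" for a x
        using that smultM Pc K.rcoset_mult_add ideal_mult[OF P(1)] by auto
      show "inv\<^bsub>add_monoid ?M\<^esub> x \<in> ?g P" if x: "x \<in> ?g P" for x
      proof -
        obtain z where z: "z \<in> P" "x = K +> z" using x by auto
        have zc: "z \<in> carrier R" using Pc z by simp
        have "inv\<^bsub>add_monoid ?M\<^esub> x = K +> (\<ominus> z)"
          unfolding m_inv_def
        proof (rule the_equality)
          have "set_add R (K +> z) (K +> \<ominus> z) = K" "set_add R (K +> \<ominus> z) (K +> z) = K"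
            using zc K.a_rcos_sum K0 by (simp_all add: r_neg l_neg)
          then show "K +> \<ominus> z \<in> carrier (add_monoid ?M) \<and> x \<otimes>\<^bsub>add_monoid ?M\<^esub> (K +> \<ominus> z) = \<one>\<^bsub>add_monoid ?M\<^esub>
              \<and> (K +> \<ominus> z) \<otimes>\<^bsub>add_monoid ?M\<^esub> x = \<one>\<^bsub>add_monoid ?M\<^esub>"
            using z zeroM addM carr ideal_neg[OF J, of z] P(2) by auto
          fix w assume "w \<in> carrier (add_monoid ?M) \<and> x \<otimes>\<^bsub>add_monoid ?M\<^esub> w = \<one>\<^bsub>add_monoid ?M\<^esub>
              \<and> w \<otimes>\<^bsub>add_monoid ?M\<^esub> x = \<one>\<^bsub>add_monoid ?M\<^esub>"
          then obtain v where v: "v \<in> J" "w = K +> v" "set_add R (K +> v) (K +> z) = K"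
            using carr addM zeroM z by auto
          have vc: "v \<in> carrier R" using v Jc by simp
          have "K +> (v \<oplus> z) = K +> \<zero>" using v(3) K.a_rcos_sum[OF vc zc] K0 by simp
          then have "v \<oplus> z \<in> K" using eq[of "v \<oplus> z" \<zero>] vc zc by (simp add: a_minus_def)
          then have "v \<ominus> \<ominus> z \<in> K" using vc zc by (simp add: a_minus_def)
          then show "w = K +> \<ominus> z" using eq[of v "\<ominus> z"] vc zc v(2) by simp
        qed
        then show ?thesis using ideal_neg[OF P(1) z(1)] by auto
      qed
    qed
    have "?g (N i) \<subset> ?g (N (Suc i))" if i: "i < n" for i
    proof -
      obtain x where x: "x \<in> N (Suc i)" "x \<notin> N i" using N(2)[OF i] by blast
      have Ni: "ideal (N i) R" "K \<subseteq> N i" "ideal (N (Suc i)) R" using N(1) i by (auto simp: ideal_chain_def)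
      have "K +> x \<notin> ?g (N i)"
      proof
        assume "K +> x \<in> ?g (N i)"
        then obtain y where y: "y \<in> N i" "K +> x = K +> y" by auto
        have c: "x \<in> carrier R" "y \<in> carrier R"
          using x y ideal.Icarr[OF Ni(1)] ideal.Icarr[OF Ni(3)] by auto
        have "x \<ominus> y \<in> N i" using eq[OF c] y Ni(2) by auto
        then have "(x \<ominus> y) \<oplus> y \<in> N i" using y ideal_add[OF Ni(1)] by simp
        moreover have "(x \<ominus> y) \<oplus> y = x" using c by algebra
        ultimately show False using x by simp
      qed
      then show ?thesis using x N(2)[OF i] by blast
    qed
    then show "enat n \<le> module_length R ?M"
      unfolding module_length_def using N(1) subm
      by (intro Sup_upper CollectI exI[of _ n] conjI refl exI[of _ "\<lambda>i. ?g (N i)"])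
        (auto simp: ideal_chain_def)
  qed
qed

lemma len_eq:
  "\<lbrakk>ideal K R; ideal J R; K \<subseteq> J\<rbrakk> \<Longrightarrow> len R J K = the_enat (ideal_length R J K)"
  by (simp add: len_def module_length_quotient)

end

section \<open>Tight closure of powers of a parameter ideal\<close>

context cring
begin

lemma binomial_ring:
  assumes xy: "x \<in> carrier R" "y \<in> carrier R"
  shows "(x \<oplus> y) [^] (n::nat) = (\<Oplus>k\<in>{..n}. add_pow R (n choose k) (x [^] k \<otimes> y [^] (n - k)))"
proof (induction n)
  case 0
  show ?case using xy by simp
next
  case (Suc n)
  let ?A = "\<lambda>k. add_pow R (n choose k) (x [^] Suc k \<otimes> y [^] (n - k))"
    and ?B = "\<lambda>k. add_pow R (n choose k) (x [^] k \<otimes> y [^] (Suc n - k))"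
    and ?C = "\<lambda>k. add_pow R (Suc n choose k) (x [^] k \<otimes> y [^] (Suc n - k))"
  let ?f = "\<lambda>k. add_pow R (n choose k) (x [^] k \<otimes> y [^] (n - k))"
  have c: "?f k \<in> carrier R" "?A k \<in> carrier R" "?B k \<in> carrier R" "?C k \<in> carrier R" for k
    using xy by auto
  have fx: "?f k \<otimes> x = ?A k" for k
    using xy by (simp add: add_pow_ldistr add_pow_rdistr m_ac)
  have fy: "?f k \<otimes> y = ?B k" if "k \<in> {..n}" for k
    using xy that by (simp add: add_pow_ldistr add_pow_rdistr Suc_diff_le m_ac)
  have "(x \<oplus> y) [^] Suc n = finsum R ?f {..n} \<otimes> x \<oplus> finsum R ?f {..n} \<otimes> y"
    using Suc xy c by (simp add: r_distr)
  also have "finsum R ?f {..n} \<otimes> x = finsum R ?A {..n}"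
    using xy c fx by (simp add: finsum_ldistr)
  also have "finsum R ?f {..n} \<otimes> y = finsum R ?B {..n}"
  proof -
    have "finsum R ?f {..n} \<otimes> y = (\<Oplus>k\<in>{..n}. ?f k \<otimes> y)"
      using xy c by (intro finsum_ldistr) auto
    also have "\<dots> = finsum R ?B {..n}" using fy c by (intro finsum_cong') auto
    finally show ?thesis .
  qed
  also have "finsum R ?B {..n} = finsum R (\<lambda>k. ?B (Suc k)) {..n} \<oplus> ?B 0"
  proof -
    have "finsum R ?B {..Suc n} = ?B (Suc n) \<oplus> finsum R ?B {..n}"
      by (intro finsum_Suc Pi_I c)
    also have "n choose Suc n = 0" by (simp add: binomial_eq_0)
    finally have "finsum R ?B {..n} = finsum R ?B {..Suc n}" using c xy by simp
    also have "\<dots> = finsum R (\<lambda>k. ?B (Suc k)) {..n} \<oplus> ?B 0"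
      by (intro finsum_Suc2 Pi_I c)
    finally show ?thesis .
  qed
  also have "finsum R ?A {..n} \<oplus> (finsum R (\<lambda>k. ?B (Suc k)) {..n} \<oplus> ?B 0)
      = finsum R (\<lambda>k. ?A k \<oplus> ?B (Suc k)) {..n} \<oplus> ?B 0"
  proof -
    have "finsum R (\<lambda>k. ?A k \<oplus> ?B (Suc k)) {..n} = finsum R ?A {..n} \<oplus> finsum R (\<lambda>k. ?B (Suc k)) {..n}"
      by (intro finsum_addf Pi_I c)
    moreover have "finsum R ?A {..n} \<in> carrier R" "finsum R (\<lambda>k. ?B (Suc k)) {..n} \<in> carrier R"
      by (intro finsum_closed Pi_I c)+
    ultimately show ?thesis using c[of 0] by (simp only: a_assoc)
  qed
  also have "finsum R (\<lambda>k. ?A k \<oplus> ?B (Suc k)) {..n} = finsum R (\<lambda>k. ?C (Suc k)) {..n}"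
    using c xy by (intro finsum_cong') (auto simp: add.nat_pow_mult)
  also have "finsum R (\<lambda>k. ?C (Suc k)) {..n} \<oplus> ?B 0 = finsum R ?C {..Suc n}"
    using c by (subst finsum_Suc2) auto
  finally show ?case .
qed

end

locale prime_char_ring = cring +
  fixes p :: nat
  assumes prime_p: "Factorial_Ring.prime p" and char_p: "add_pow R p \<one> = \<zero>"
begin

lemma char_dvd: "\<lbrakk>p dvd n; x \<in> carrier R\<rbrakk> \<Longrightarrow> add_pow R n x = \<zero>"
proof -
  assume "p dvd n" and x: "x \<in> carrier R"
  then obtain k where n: "n = p * k" by auto
  have "add_pow R p y = \<zero>" if "y \<in> carrier R" for y
    using add_pow_ldistr[of \<one> y p] that char_p by simp
  then have "add_pow R p (add_pow R k x) = \<zero>" using x by simp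
  then show ?thesis using x n by (simp add: add.nat_pow_pow mult.commute)
qed

lemma frobenius_add:
  assumes xy: "x \<in> carrier R" "y \<in> carrier R"
  shows "(x \<oplus> y) [^] p = x [^] p \<oplus> y [^] p"
proof -
  obtain n where p: "p = Suc n" and n: "n \<noteq> 0"
    using prime_gt_1_nat[OF prime_p] by (cases p) auto
  let ?f = "\<lambda>k. add_pow R (p choose k) (x [^] k \<otimes> y [^] (p - k))"
  have c: "?f k \<in> carrier R" for k using xy by auto
  have z: "?f k = \<zero>" if "0 < k" "k < p" for k
    using that xy by (intro char_dvd dvd_choose_prime prime_p) auto
  have "(x \<oplus> y) [^] p = finsum R ?f {..Suc n}" using binomial_ring[OF xy, of p] p by simp
  also have "\<dots> = ?f (Suc n) \<oplus> finsum R ?f {..n}" by (intro finsum_Suc Pi_I c)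
  also have "finsum R ?f {..n} = finsum R ?f {0}"
    using c z p by (intro add.finprod_mono_neutral_cong_right) auto
  also have "\<dots> = y [^] p" using xy by (simp add: finsum_insert)
  finally show ?thesis using xy p by simp
qed

lemma frobenius_pow_add:
  assumes "x \<in> carrier R" "y \<in> carrier R"
  shows "(x \<oplus> y) [^] (p ^ e) = x [^] (p ^ e) \<oplus> y [^] (p ^ e)"
proof (induction e)
  case (Suc e)
  have "(x \<oplus> y) [^] (p ^ Suc e) = ((x \<oplus> y) [^] (p ^ e)) [^] p"
    using assms by (simp add: nat_pow_pow mult.commute)
  also have "\<dots> = (x [^] (p ^ e)) [^] p \<oplus> (y [^] (p ^ e)) [^] p"
    using assms by (simp add: Suc frobenius_add)
  finally show ?case using assms by (simp add: nat_pow_pow mult.commute)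
qed (use assms in simp)

lemma p_pow_pos: "p ^ e > 0"
  using prime_gt_0_nat[OF prime_p] by simp

lemma frobenius_Idl:
  assumes K: "ideal K R" and "A \<subseteq> carrier R" "\<And>a. a \<in> A \<Longrightarrow> a [^] (p ^ e) \<in> K" and x: "x \<in> Idl A"
  shows "x [^] (p ^ e) \<in> K"
proof -
  have "ideal {x \<in> carrier R. x [^] (p ^ e) \<in> K} R"
  proof (rule idealI_cring)
    have "\<zero> [^] (p ^ e) = \<zero>" using p_pow_pos[of e] by (simp add: nat_pow_zero)
    then show "\<zero> \<in> {x \<in> carrier R. x [^] (p ^ e) \<in> K}" using ideal_zero[OF K] by simp
  qed (auto simp: frobenius_pow_add nat_pow_distrib intro!: ideal_add[OF K] ideal_mult[OF K])
  then have "Idl A \<subseteq> {x \<in> carrier R. x [^] (p ^ e) \<in> K}" using assms by (intro genideal_minimal) auto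
  with x show ?thesis by blast
qed

lemma frobenius_power_ideal:
  assumes "ideal J R"
  shows "ideal (frobenius_power R q J) R" "\<And>x. x \<in> J \<Longrightarrow> x [^] q \<in> frobenius_power R q J"
proof -
  have c: "(\<lambda>a. a [^] q) ` J \<subseteq> carrier R" using ideal.Icarr[OF assms] by auto
  show "ideal (frobenius_power R q J) R" unfolding frobenius_power_def by (rule genideal_ideal[OF c])
  show "\<And>x. x \<in> J \<Longrightarrow> x [^] q \<in> frobenius_power R q J"
    unfolding frobenius_power_def using genideal_self[OF c] by auto
qed

abbreviation tc :: "'a set \<Rightarrow> 'a set" where "tc \<equiv> tight_closure R p"

definition test_elements :: "'a set" where
  "test_elements = {c \<in> carrier R. \<forall>P. minimal_prime R P \<longrightarrow> c \<notin> P}"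

lemma tc_iff: "x \<in> tc J \<longleftrightarrow> x \<in> carrier R \<and> (\<exists>c\<in>test_elements.
    \<forall>\<^sub>F e in sequentially. c \<otimes> x [^] (p ^ e) \<in> frobenius_power R (p ^ e) J)"
  by (auto simp: tight_closure_def test_elements_def)

lemma test_elements_one: "\<one> \<in> test_elements"
  unfolding test_elements_def minimal_prime_def
  using primeideal.I_notcarr ideal.one_imp_carrier primeideal.axioms(1) by blast

lemma test_elements_mult: "\<lbrakk>c \<in> test_elements; c' \<in> test_elements\<rbrakk> \<Longrightarrow> c \<otimes> c' \<in> test_elements"
  unfolding test_elements_def minimal_prime_def
  using primeideal.I_prime[of _ R c c'] by blast

lemma tc_superset:
  assumes "ideal J R"
  shows "J \<subseteq> tc J"
proof
  fix x assume x: "x \<in> J"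
  then have "x \<in> carrier R" using ideal.Icarr[OF assms] by simp
  with x show "x \<in> tc J"
    using test_elements_one frobenius_power_ideal(2)[OF assms x]
    by (auto simp: tc_iff intro!: bexI[of _ \<one>])
qed

lemma tc_times:
  assumes B: "ideal B R" and C: "ideal C R" and a: "a \<in> carrier R" "\<And>b. b \<in> B \<Longrightarrow> a \<otimes> b \<in> C"
    and x: "x \<in> tc B"
  shows "a \<otimes> x \<in> tc C"
proof -
  obtain c where c: "c \<in> test_elements" "x \<in> carrier R"
    and ev: "\<forall>\<^sub>F e in sequentially. c \<otimes> x [^] (p ^ e) \<in> frobenius_power R (p ^ e) B"
    using x by (auto simp: tc_iff)
  have cc: "c \<in> carrier R" using c by (simp add: test_elements_def)
  have "c \<otimes> (a \<otimes> x) [^] q \<in> frobenius_power R q C"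
    if e: "c \<otimes> x [^] q \<in> frobenius_power R q B" for q :: nat
  proof -
    note Cq = frobenius_power_ideal[where q = q, OF C]
    have "a [^] q \<otimes> (c \<otimes> x [^] q) \<in> frobenius_power R q C"
    proof (rule Idl_mult_mem[OF Cq(1)])
      show "c \<otimes> x [^] q \<in> Idl ((\<lambda>b. b [^] q) ` B)" using e by (simp add: frobenius_power_def)
      show "a [^] q \<in> Idl {a [^] q}" using genideal_self'[of "a [^] q"] a by simp
      show "(\<lambda>b. b [^] q) ` B \<subseteq> carrier R" using ideal.Icarr[OF B] by auto
      fix u v assume "u \<in> {a [^] q}" "v \<in> (\<lambda>b. b [^] q) ` B"
      then obtain b where b: "b \<in> B" "u = a [^] q" "v = b [^] q" by auto
      then have "u \<otimes> v = (a \<otimes> b) [^] q" using a(1) ideal.Icarr[OF B b(1)] by (simp add: nat_pow_distrib)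
      then show "u \<otimes> v \<in> frobenius_power R q C" using Cq(2)[OF a(2)[OF b(1)]] by simp
    qed (use a in simp)
    also have "a [^] q \<otimes> (c \<otimes> x [^] q) = c \<otimes> (a \<otimes> x) [^] q"
      using a cc c by (simp add: nat_pow_distrib m_ac)
    finally show ?thesis .
  qed
  then have "\<forall>\<^sub>F e in sequentially. c \<otimes> (a \<otimes> x) [^] (p ^ e) \<in> frobenius_power R (p ^ e) C"
    by (intro eventually_mono[OF ev])
  then show ?thesis using a c by (auto simp: tc_iff)
qed

lemma tc_ideal:
  assumes J: "ideal J R"
  shows "ideal (tc J) R"
proof (rule idealI_cring)
  show "tc J \<subseteq> carrier R" by (auto simp: tc_iff)
  show "\<zero> \<in> tc J" using tc_superset[OF J] ideal_zero[OF J] by blast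
  show "a \<otimes> x \<in> tc J" if "a \<in> carrier R" "x \<in> tc J" for a x
    using that by (intro tc_times[OF J J]) (auto intro: ideal_mult[OF J])
  fix x y assume x: "x \<in> tc J" and y: "y \<in> tc J"
  obtain c where c: "c \<in> test_elements" "x \<in> carrier R"
    and cx: "\<forall>\<^sub>F e in sequentially. c \<otimes> x [^] (p ^ e) \<in> frobenius_power R (p ^ e) J"
    using x by (auto simp: tc_iff)
  obtain d where d: "d \<in> test_elements" "y \<in> carrier R"
    and dy: "\<forall>\<^sub>F e in sequentially. d \<otimes> y [^] (p ^ e) \<in> frobenius_power R (p ^ e) J"
    using y by (auto simp: tc_iff)
  have cd: "c \<in> carrier R" "d \<in> carrier R" using c d by (auto simp: test_elements_def)
  have "\<forall>\<^sub>F e in sequentially. (c \<otimes> d) \<otimes> (x \<oplus> y) [^] (p ^ e) \<in> frobenius_power R (p ^ e) J"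
    using cx dy
  proof eventually_elim
    case (elim e)
    note F = frobenius_power_ideal(1)[OF J]
    let ?u = "x [^] (p ^ e)" and ?v = "y [^] (p ^ e)"
    have uv: "?u \<in> carrier R" "?v \<in> carrier R" using c d by auto
    have "d \<otimes> (c \<otimes> ?u) \<oplus> c \<otimes> (d \<otimes> ?v) \<in> frobenius_power R (p ^ e) J"
      by (rule ideal_add[OF F ideal_mult[OF F elim(1) cd(2)] ideal_mult[OF F elim(2) cd(1)]])
    also have "d \<otimes> (c \<otimes> ?u) \<oplus> c \<otimes> (d \<otimes> ?v) = (c \<otimes> d) \<otimes> (?u \<oplus> ?v)"
      using uv cd by algebra
    finally show ?case using c d by (simp add: frobenius_pow_add)
  qed
  then show "x \<oplus> y \<in> tc J" using c d test_elements_mult by (auto simp: tc_iff)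
qed

lemma ideal_pow_add:
  assumes "ideal I R"
  shows "ideal_prod R (ideal_pow R I k) (ideal_pow R I n) = ideal_pow R I (k + n)"
proof (induction n)
  case (Suc n)
  then show ?case
    using ideal_prod_assoc[OF ideal_pow_ideal[OF assms, of k] ideal_pow_ideal[OF assms, of n] assms] by simp
qed (simp add: ideal_prod_one ideal_pow_ideal assms)

lemma tc_times_ideal_pow:
  assumes I: "ideal I R"
  shows "ideal_prod R (tc (ideal_pow R I k)) (ideal_pow R I n) \<subseteq> tc (ideal_pow R I (k + n))"
proof (rule ideal_prod_subset)
  note P = ideal_pow_ideal[OF I]
  show "ideal (tc (ideal_pow R I (k + n))) R" by (intro tc_ideal P)
  fix x a assume x: "x \<in> tc (ideal_pow R I k)" and a: "a \<in> ideal_pow R I n"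
  have ac: "a \<in> carrier R" using ideal.Icarr[OF P a] .
  have xc: "x \<in> carrier R" using x by (simp add: tc_iff)
  have "a \<otimes> b \<in> ideal_pow R I (k + n)" if "b \<in> ideal_pow R I k" for b
    using ideal_prod.prod[OF that a, of R] m_comm[OF ac ideal.Icarr[OF P that]] ideal_pow_add[OF I] by simp
  then have "a \<otimes> x \<in> tc (ideal_pow R I (k + n))" using tc_times[OF P P ac _ x] by blast
  then show "x \<otimes> a \<in> tc (ideal_pow R I (k + n))" using m_comm[OF ac xc] by simp
qed

text \<open>If \<open>x = \<Sum> a\<^sub>\<alpha> z\<^sup>\<alpha>\<close> then \<open>c x\<^sup>q = \<Sum> c a\<^sub>\<alpha>\<^sup>q z\<^sup>q\<^sup>\<alpha>\<close>, and the \<open>z\<^sub>i\<^sup>q\<close> again generate an ideal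
  containing powers of a regular sequence, so that the coefficients \<open>c a\<^sub>\<alpha>\<^sup>q\<close> lie in \<open>I\<^sup>[\<^sup>q\<^sup>]\<close>.\<close>

lemma tc_coefficient:
  assumes zs: "param_list zs" and I: "I = Idl (set zs)" and B: "B \<subseteq> exponents (length zs) n"
    and \<alpha>: "\<alpha> \<in> exponents (length zs) n" "\<alpha> \<notin> B"
    and a: "a \<in> carrier R" and y: "y \<in> Idl (power_prod R zs ` B)"
    and x: "a \<otimes> power_prod R zs \<alpha> \<oplus> y \<in> tc (ideal_pow R I (Suc n))"
  shows "a \<in> tc I"
proof -
  have zc: "set zs \<subseteq> carrier R" by (rule param_list_carrier[OF zs])
  let ?u = "power_prod R zs"
  have uc: "?u \<beta> \<in> carrier R" for \<beta> using zc by simp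
  have Bc: "?u ` B \<subseteq> carrier R" using uc by auto
  have yc: "y \<in> carrier R" using ideal.Icarr[OF genideal_ideal[OF Bc] y] .
  have Ii: "ideal I R" unfolding I by (rule Idl_ideal[OF zc])
  obtain c where c: "c \<in> test_elements"
    and ev: "\<forall>\<^sub>F e in sequentially. c \<otimes> (a \<otimes> ?u \<alpha> \<oplus> y) [^] (p ^ e)
      \<in> frobenius_power R (p ^ e) (ideal_pow R I (Suc n))"
    using x by (auto simp: tc_iff)
  have cc: "c \<in> carrier R" using c by (simp add: test_elements_def)
  have "c \<otimes> a [^] (p ^ e) \<in> frobenius_power R (p ^ e) I"
    if e: "c \<otimes> (a \<otimes> ?u \<alpha> \<oplus> y) [^] (p ^ e) \<in> frobenius_power R (p ^ e) (ideal_pow R I (Suc n))" for e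
  proof -
    let ?q = "p ^ e" and ?zq = "map (\<lambda>z. z [^] (p ^ e)) zs"
    have zq: "param_list ?zq" by (rule param_list_pow[OF zs])
    have zqc: "set ?zq \<subseteq> carrier R" by (rule param_list_carrier[OF zq])
    let ?Q = "Idl (set (succ_powers R ?zq \<alpha>))"
    have Q: "ideal ?Q R" by (intro Idl_ideal succ_powers_closed zqc)
    have uq: "?u \<beta> [^] ?q = power_prod R ?zq \<beta>" for \<beta> by (simp add: power_prod_pow[OF zc])
    have mem: "?u \<beta> [^] ?q \<in> ?Q" if "\<beta> \<in> exponents (length zs) k" "n \<le> k" "\<beta> \<noteq> \<alpha>" for \<beta> k
      unfolding uq using that \<alpha> by (intro power_prod_mem_succ_powers zqc) (auto simp: exponents_def)
    have yq: "y [^] ?q \<in> ?Q"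
      by (rule frobenius_Idl[OF Q Bc _ y]) (use B \<alpha> mem in auto)
    have "frobenius_power R ?q (ideal_pow R I (Suc n)) \<subseteq> ?Q"
      unfolding frobenius_power_def
    proof (rule genideal_minimal[OF Q], clarify)
      fix b assume b: "b \<in> ideal_pow R I (Suc n)"
      show "b [^] ?q \<in> ?Q"
      proof (rule frobenius_Idl[OF Q power_prod_in_carrier[OF zc]])
        show "b \<in> Idl (?u ` exponents (length zs) (Suc n))"
          using b unfolding I ideal_pow_power_prod[OF zc] .
        show "w [^] ?q \<in> ?Q" if w: "w \<in> ?u ` exponents (length zs) (Suc n)" for w
        proof -
          obtain \<beta> where \<beta>: "\<beta> \<in> exponents (length zs) (Suc n)" "w = ?u \<beta>" using w by blast
          then have "\<beta> \<noteq> \<alpha>" using \<alpha>(1) by (auto simp: exponents_def)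
          then show ?thesis using mem[OF \<beta>(1)] \<beta>(2) by simp
        qed
      qed
    qed
    with e have "c \<otimes> (a \<otimes> ?u \<alpha> \<oplus> y) [^] ?q \<in> ?Q" by blast
    also have "c \<otimes> (a \<otimes> ?u \<alpha> \<oplus> y) [^] ?q = (c \<otimes> a [^] ?q) \<otimes> power_prod R ?zq \<alpha> \<oplus> c \<otimes> y [^] ?q"
    proof -
      have "(a \<otimes> ?u \<alpha> \<oplus> y) [^] ?q = a [^] ?q \<otimes> ?u \<alpha> [^] ?q \<oplus> y [^] ?q"
        using a uc[of \<alpha>] yc by (simp add: frobenius_pow_add nat_pow_distrib)
      moreover have "c \<otimes> (s \<otimes> t \<oplus> v) = (c \<otimes> s) \<otimes> t \<oplus> c \<otimes> v"
        if "s \<in> carrier R" "t \<in> carrier R" "v \<in> carrier R" for s t v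
        using that cc by algebra
      ultimately show ?thesis using a uc[of \<alpha>] yc unfolding uq[of \<alpha>, symmetric] by simp
    qed
    finally have sum: "(c \<otimes> a [^] ?q) \<otimes> power_prod R ?zq \<alpha> \<oplus> c \<otimes> y [^] ?q \<in> ?Q" .
    have "(c \<otimes> a [^] ?q) \<otimes> power_prod R ?zq \<alpha> \<in> ?Q"
      by (rule ideal_add_cancel[OF Q sum ideal_mult[OF Q yq cc]])
        (intro m_closed cc nat_pow_closed a power_prod_closed zqc)
    then have "c \<otimes> a [^] ?q \<in> Idl (set ?zq)"
      using power_prod_colon[OF zq, of \<alpha>] \<alpha>(1) a cc by (simp add: exponents_def)
    also have "Idl (set ?zq) \<subseteq> frobenius_power R ?q I"
      using frobenius_power_ideal[where q = ?q, OF Ii] mem_Idl_set[OF zc] I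
      by (intro genideal_minimal) auto
    finally show ?thesis .
  qed
  then have "\<forall>\<^sub>F e in sequentially. c \<otimes> a [^] (p ^ e) \<in> frobenius_power R (p ^ e) I"
    by (intro eventually_mono[OF ev])
  then show ?thesis using a c by (auto simp: tc_iff)
qed

lemma tc_Int_ideal_pow:
  assumes zs: "param_list zs" and I: "I = Idl (set zs)"
  shows "tc (ideal_pow R I (Suc n)) \<inter> ideal_pow R I n = ideal_prod R (tc I) (ideal_pow R I n)"
proof
  have zc: "set zs \<subseteq> carrier R" by (rule param_list_carrier[OF zs])
  have Ii: "ideal I R" unfolding I by (rule Idl_ideal[OF zc])
  note P = ideal_pow_ideal[OF Ii]
  have I1: "ideal_pow R I 1 = I" using ideal_prod_commute[OF oneideal Ii] ideal_prod_one[OF Ii] by simp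
  show sup: "ideal_prod R (tc I) (ideal_pow R I n) \<subseteq> tc (ideal_pow R I (Suc n)) \<inter> ideal_pow R I n"
    using tc_times_ideal_pow[OF Ii, of 1 n] ideal_prod_inter[OF tc_ideal[OF Ii] P] I1 by auto
  let ?u = "power_prod R zs" and ?E = "exponents (length zs) n"
  let ?T = "tc (ideal_pow R I (Suc n))" and ?S = "ideal_prod R (tc I) (ideal_pow R I n)"
  have S: "ideal ?S R" by (intro ideal_prod_is_ideal tc_ideal Ii P)
  have T: "ideal ?T R" by (intro tc_ideal P)
  have "x \<in> ?S" if "finite B" "B \<subseteq> ?E" "x \<in> Idl (?u ` B)" "x \<in> ?T" for B x
    using that
  proof (induction B arbitrary: x rule: finite_induct)
    case empty
    then show ?case using ideal_zero[OF S] by (simp add: Idl_empty)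
  next
    case (insert \<alpha> B)
    have uc: "?u \<alpha> \<in> carrier R" using zc by simp
    obtain a y where ay: "a \<in> carrier R" "y \<in> Idl (?u ` B)" "x = a \<otimes> ?u \<alpha> \<oplus> y"
      using insert.prems(2) mem_Idl_insert[OF uc power_prod_in_carrier[OF zc], of x B] by auto
    have yc: "y \<in> carrier R" using ideal.Icarr[OF genideal_ideal[OF power_prod_in_carrier[OF zc]] ay(2)] .
    have "a \<in> tc I"
      using insert.prems insert.hyps ay by (intro tc_coefficient[OF zs I, of B n \<alpha> a y]) auto
    moreover have "?u \<alpha> \<in> ideal_pow R I n"
      unfolding I ideal_pow_power_prod[OF zc]
      using insert.prems(1) genideal_self[OF power_prod_in_carrier[OF zc], of ?E] by blast
    ultimately have au: "a \<otimes> ?u \<alpha> \<in> ?S" by (rule ideal_prod.prod)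
    have "y = x \<ominus> a \<otimes> ?u \<alpha>" unfolding ay(3) using ay(1) yc uc by algebra
    also have "\<dots> \<in> ?T" using insert.prems(3) au sup by (intro ideal_diff[OF T]) auto
    finally have "y \<in> ?S" using insert.prems(1) by (intro insert.IH ay(2)) auto
    then show ?case unfolding ay(3) using au by (intro ideal_add[OF S])
  qed
  from this[OF finite_exponents subset_refl]
  show "?T \<inter> ideal_pow R I n \<subseteq> ?S"
    unfolding I ideal_pow_power_prod[OF zc] by auto
qed

end

section \<open>The tight Hilbert function\<close>

locale tight_parameters = prime_char_ring +
  fixes zs :: "'a list" and I :: "'a set"
  assumes zs: "param_list zs" and I: "I = Idl (set zs)"
    and finite_length: "ideal_length R (carrier R) I < \<infinity>"
begin

lemma zs_carrier: "set zs \<subseteq> carrier R"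
  by (rule param_list_carrier[OF zs])

lemma I_ideal: "ideal I R"
  unfolding I by (rule Idl_ideal[OF zs_carrier])

lemma pow_ideal: "ideal (ideal_pow R I n) R"
  by (rule ideal_pow_ideal[OF I_ideal])

lemma I_pow_1: "ideal_pow R I 1 = I"
  using ideal_prod_commute[OF oneideal I_ideal] ideal_prod_one[OF I_ideal] by simp

lemma I_pow_Suc_left: "ideal_pow R I (Suc n) = ideal_prod R I (ideal_pow R I n)"
  using ideal_prod_commute[OF I_ideal pow_ideal, of n] by simp

lemma I_pow_Suc_subset: "ideal_pow R I (Suc n) \<subseteq> ideal_pow R I n"
  using ideal_prod_inter[OF pow_ideal I_ideal] by auto

lemma ideal_prod_mono: "\<lbrakk>A \<subseteq> A'; B \<subseteq> B'\<rbrakk> \<Longrightarrow> ideal_prod R A B \<subseteq> ideal_prod R A' B'"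
proof
  fix x assume s: "A \<subseteq> A'" "B \<subseteq> B'" and "x \<in> ideal_prod R A B"
  from this(3) show "x \<in> ideal_prod R A' B'"
    by induction (use s in \<open>auto intro: ideal_prod.intros\<close>)
qed

abbreviation monomial_count :: "nat \<Rightarrow> nat" where "monomial_count n \<equiv> card (exponents (length zs) n)"

lemma length_times_pow:
  assumes K: "ideal K R" and IK: "I \<subseteq> K"
  shows "ideal_length R (ideal_prod R K (ideal_pow R I n)) (ideal_pow R I (Suc n)) = enat (monomial_count n) * ideal_length R K I"
proof -
  let ?E = "exponents (length zs) n" and ?u = "power_prod R zs" and ?W = "ideal_pow R I (Suc n)"
  let ?Q = "\<lambda>\<alpha>. Idl (set (succ_powers R zs \<alpha>))"
  have uI: "?u \<alpha> \<in> ideal_pow R I n" if "\<alpha> \<in> ?E" for \<alpha>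
    unfolding I ideal_pow_power_prod[OF zs_carrier]
    using that genideal_self[OF power_prod_in_carrier[OF zs_carrier], of ?E] by blast
  have S: "ideal (span_over K ?u ?E ?W) R"
    "{k \<otimes> ?u b | k b. k \<in> K \<and> b \<in> ?E} \<union> ?W \<subseteq> span_over K ?u ?E ?W"
    by (rule span_over_ideal[OF K pow_ideal], rule power_prod_closed[OF zs_carrier])+
  have KP: "ideal (ideal_prod R K (ideal_pow R I n)) R" by (rule ideal_prod_is_ideal[OF K pow_ideal])
  have "span_over K ?u ?E ?W = ideal_prod R K (ideal_pow R I n)"
  proof
    show "span_over K ?u ?E ?W \<subseteq> ideal_prod R K (ideal_pow R I n)"
    proof (rule span_over_least[OF KP])
      show "?W \<subseteq> ideal_prod R K (ideal_pow R I n)"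
        unfolding I_pow_Suc_left by (rule ideal_prod_mono[OF IK subset_refl])
    qed (use uI in \<open>auto intro: ideal_prod.prod\<close>)
    show "ideal_prod R K (ideal_pow R I n) \<subseteq> span_over K ?u ?E ?W"
    proof (rule ideal_prod_subset[OF S(1)])
      fix k x assume k: "k \<in> K" and "x \<in> ideal_pow R I n"
      then have x: "x \<in> Idl (?u ` ?E)" unfolding I ideal_pow_power_prod[OF zs_carrier] by simp
      have kI: "k \<in> Idl K" using genideal_self[OF ideal_subset[OF K]] k by blast
      show "k \<otimes> x \<in> span_over K ?u ?E ?W"
        by (rule Idl_mult_mem[OF S(1) ideal_subset[OF K] power_prod_in_carrier[OF zs_carrier] _ kI x])
          (use S(2) in blast)
    qed
  qed
  moreover have "ideal_length R (span_over K ?u ?E ?W) ?W = enat (monomial_count n) * ideal_length R K I"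
  proof (rule ideal_length_span_over[OF K pow_ideal finite_exponents _ IK, where Q = ?Q])
    show "?u \<alpha> \<in> carrier R" for \<alpha> using zs_carrier by simp
    show "k \<otimes> ?u \<alpha> \<in> ?W" if "k \<in> I" "\<alpha> \<in> ?E" for k \<alpha>
      using ideal_prod.prod[OF that(1) uI[OF that(2)], of R] ideal_prod_commute[OF I_ideal pow_ideal] by simp
    show "ideal (?Q \<alpha>) R" for \<alpha> by (intro Idl_ideal succ_powers_closed zs_carrier)
    show "?W \<subseteq> ?Q \<alpha>" if "\<alpha> \<in> ?E" for \<alpha>
      unfolding I by (rule ideal_pow_subset_succ_powers[OF zs_carrier that]) simp
    show "?u \<beta> \<in> ?Q \<alpha>" if "\<alpha> \<in> ?E" "\<beta> \<in> ?E" "\<beta> \<noteq> \<alpha>" for \<alpha> \<beta>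
      using that by (intro power_prod_mem_succ_powers zs_carrier) (auto simp: exponents_def)
    show "k \<in> I" if "\<alpha> \<in> ?E" "k \<in> carrier R" "k \<otimes> ?u \<alpha> \<in> ?Q \<alpha>" for \<alpha> k
      unfolding I using that by (intro power_prod_colon[OF zs, of \<alpha>]) (auto simp: exponents_def)
  qed
  ultimately show ?thesis by simp
qed

lemma length_pow: "ideal_length R (carrier R) (ideal_pow R I n) = enat (\<Sum>i<n. monomial_count i) * ideal_length R (carrier R) I"
proof (induction n)
  case (Suc n)
  have "ideal_prod R (carrier R) (ideal_pow R I n) = ideal_pow R I n"
    using ideal_prod_commute[OF oneideal pow_ideal] ideal_prod_one[OF pow_ideal] by simp
  then have "ideal_length R (ideal_pow R I n) (ideal_pow R I (Suc n)) = enat (monomial_count n) * ideal_length R (carrier R) I"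
    using length_times_pow[OF oneideal ideal_subset[OF I_ideal], of n] by simp
  moreover have "ideal_length R (carrier R) (ideal_pow R I (Suc n))
      = ideal_length R (carrier R) (ideal_pow R I n) + ideal_length R (ideal_pow R I n) (ideal_pow R I (Suc n))"
    by (intro ideal_length_add pow_ideal oneideal I_pow_Suc_subset ideal_subset)
  ultimately show ?case using Suc by (simp add: distrib_right flip: plus_enat_simps(1))
qed (simp add: zero_enat_def[symmetric])

definition above_pow :: "'a set \<Rightarrow> bool" where
  "above_pow K \<longleftrightarrow> ideal K R \<and> (\<exists>n. ideal_pow R I n \<subseteq> K)"

lemma above_powI: "\<lbrakk>ideal K R; ideal_pow R I n \<subseteq> K\<rbrakk> \<Longrightarrow> above_pow K"
  by (auto simp: above_pow_def)

lemma above_pow_ideal: "above_pow K \<Longrightarrow> ideal K R"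
  by (simp add: above_pow_def)

lemma above_pow_mono: "\<lbrakk>above_pow K; ideal J R; K \<subseteq> J\<rbrakk> \<Longrightarrow> above_pow J"
  by (auto simp: above_pow_def)

lemma ideal_length_enat:
  assumes K: "above_pow K" and J: "ideal J R" and KJ: "K \<subseteq> J"
  shows "ideal_length R J K = enat (len R J K)"
proof -
  have Ki: "ideal K R" using K by (rule above_pow_ideal)
  obtain n where n: "ideal_pow R I n \<subseteq> K" using K by (auto simp: above_pow_def)
  obtain a where a: "ideal_length R (carrier R) I = enat a" using finite_length by auto
  have "ideal_length R (carrier R) (ideal_pow R I n)
      = ideal_length R (carrier R) J + (ideal_length R J K + ideal_length R K (ideal_pow R I n))"
    using ideal_length_add[OF pow_ideal J oneideal, of n] ideal_length_add[OF pow_ideal Ki J n KJ] n KJ ideal_subset[OF J]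
    by (simp add: order_trans[OF n KJ])
  moreover have "ideal_length R (carrier R) (ideal_pow R I n) \<noteq> \<infinity>"
    using length_pow[of n] a by simp
  ultimately have "ideal_length R J K \<noteq> \<infinity>" by (metis plus_enat_simps(2,3))
  then show ?thesis using len_eq[OF Ki J KJ] by auto
qed

lemma len_add:
  assumes K: "above_pow K" and M: "ideal M R" and J: "ideal J R" and s: "K \<subseteq> M" "M \<subseteq> J"
  shows "len R J K = len R J M + len R M K"
proof -
  have "enat (len R J K) = enat (len R J M) + enat (len R M K)"
    using ideal_length_add[OF above_pow_ideal[OF K] M J s]
      ideal_length_enat[OF K J] ideal_length_enat[OF K M s(1)]
      ideal_length_enat[OF above_pow_mono[OF K M s(1)] J s(2)] s by simp
  then show ?thesis by simp
qed

lemma len_eq_0: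
  assumes K: "above_pow K" and J: "ideal J R" and KJ: "K \<subseteq> J" and "len R J K = 0"
  shows "J = K"
proof (rule ccontr)
  assume "J \<noteq> K"
  then have "1 \<le> ideal_length R J K"
    using KJ by (intro ideal_length_pos J above_pow_ideal[OF K]) auto
  then show False using ideal_length_enat[OF K J KJ] assms(4) by (simp add: one_enat_def)
qed

lemma len_second_iso:
  assumes "above_pow A" "above_pow B" "above_pow (A \<inter> B)"
  shows "len R (set_add R A B) B = len R A (A \<inter> B)"
proof -
  note i = assms[THEN above_pow_ideal]
  have "enat (len R (set_add R A B) B) = enat (len R A (A \<inter> B))"
    using ideal_length_second_iso[OF i(1,2)] ideal_length_enat[OF assms(2) add_ideals[OF i(1,2)]]
      ideal_length_enat[OF assms(3) i(1)] set_add_upper[OF i(1,2)] by simp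
  then show ?thesis by simp
qed

lemma len_times_pow:
  assumes K: "ideal K R" and IK: "I \<subseteq> K"
  shows "ideal_pow R I (Suc n) \<subseteq> ideal_prod R K (ideal_pow R I n)"
    and "len R (ideal_prod R K (ideal_pow R I n)) (ideal_pow R I (Suc n)) = monomial_count n * len R K I"
proof -
  show sub: "ideal_pow R I (Suc n) \<subseteq> ideal_prod R K (ideal_pow R I n)"
    unfolding I_pow_Suc_left by (rule ideal_prod_mono[OF IK subset_refl])
  have "above_pow I" using above_powI[OF I_ideal, of 1] I_pow_1 by simp
  then have "enat (len R (ideal_prod R K (ideal_pow R I n)) (ideal_pow R I (Suc n))) = enat (monomial_count n * len R K I)"
    using length_times_pow[OF K IK, of n] ideal_length_enat[OF _ K IK]
      ideal_length_enat[OF above_powI[OF pow_ideal subset_refl] ideal_prod_is_ideal[OF K pow_ideal] sub]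
    by simp
  then show "len R (ideal_prod R K (ideal_pow R I n)) (ideal_pow R I (Suc n)) = monomial_count n * len R K I"
    by simp
qed

lemma len_pow: "len R (carrier R) (ideal_pow R I n) = (\<Sum>i<n. monomial_count i) * len R (carrier R) I"
proof -
  have "above_pow I" using above_powI[OF I_ideal, of 1] I_pow_1 by simp
  then have "enat (len R (carrier R) (ideal_pow R I n)) = enat ((\<Sum>i<n. monomial_count i) * len R (carrier R) I)"
    using length_pow[of n] ideal_length_enat[OF above_powI[OF pow_ideal subset_refl] oneideal ideal_subset[OF pow_ideal]]
      ideal_length_enat[OF _ oneideal ideal_subset[OF I_ideal]] by simp
  then show ?thesis by simp
qed

abbreviation T :: "nat \<Rightarrow> 'a set" where "T n \<equiv> tc (ideal_pow R I n)"

lemma T_ideal: "ideal (T n) R"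
  by (intro tc_ideal pow_ideal)

lemma I_subset_tc: "I \<subseteq> tc I"
  by (rule tc_superset[OF I_ideal])

lemma above_pow_T: "above_pow (T n)"
  by (rule above_powI[OF T_ideal tc_superset[OF pow_ideal]])

lemma T_Int: "T (Suc n) \<inter> ideal_pow R I n = ideal_prod R (tc I) (ideal_pow R I n)"
  by (rule tc_Int_ideal_pow[OF zs I])

lemma tcI_pow_subset: "ideal_prod R (tc I) (ideal_pow R I n) \<subseteq> T (Suc n)"
  using T_Int by blast

lemma above_pow_tcI_pow: "above_pow (ideal_prod R (tc I) (ideal_pow R I n))"
  by (rule above_powI[OF ideal_prod_is_ideal[OF tc_ideal[OF I_ideal] pow_ideal] len_times_pow(1)[OF tc_ideal[OF I_ideal] I_subset_tc]])

lemma T_length_sum: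
  "len R (carrier R) (T (Suc n)) + len R (T (Suc n)) (ideal_prod R (tc I) (ideal_pow R I n)) + monomial_count n * len R (tc I) I
    = (\<Sum>i\<le>n. monomial_count i) * len R (carrier R) I"
proof -
  let ?S = "ideal_prod R (tc I) (ideal_pow R I n)"
  note S = above_pow_tcI_pow[of n] and W = above_powI[OF pow_ideal subset_refl, of "Suc n"]
  have "len R (carrier R) (ideal_pow R I (Suc n)) = len R (carrier R) ?S + len R ?S (ideal_pow R I (Suc n))"
    by (intro len_add W above_pow_ideal[OF S] oneideal len_times_pow(1) tc_ideal I_ideal I_subset_tc ideal_subset)
  also have "len R (carrier R) ?S = len R (carrier R) (T (Suc n)) + len R (T (Suc n)) ?S"
    by (intro len_add S T_ideal oneideal tcI_pow_subset ideal_subset)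
  also have "len R ?S (ideal_pow R I (Suc n)) = monomial_count n * len R (tc I) I"
    by (intro len_times_pow(2) tc_ideal I_ideal I_subset_tc)
  finally show ?thesis using len_pow[of "Suc n"] by (simp add: lessThan_Suc_atMost)
qed

text \<open>The ideal on the right is contained in the one on the left, and both have the same intersection
  with \<open>I\<^sup>n\<^sup>+\<^sup>1\<close> by \<open>T_Int\<close>; so they agree iff their images modulo \<open>I\<^sup>n\<^sup>+\<^sup>1\<close> have the same length.\<close>

lemma T_eq_iff:
  "T (Suc (Suc n)) = ideal_prod R (T 2) (ideal_pow R I n) \<longleftrightarrow>
    len R (T (Suc (Suc n))) (ideal_prod R (tc I) (ideal_pow R I (Suc n)))
      = monomial_count n * len R (T 2) (ideal_prod R I (tc I))"
proof -
  let ?W = "ideal_pow R I (Suc n)" and ?T = "T (Suc (Suc n))"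
  let ?L = "len R (T 2) (ideal_prod R I (tc I))" and ?TP = "ideal_prod R (T 2) (ideal_pow R I n)"
  have aI: "above_pow I" using above_powI[OF I_ideal, of 1] I_pow_1 by simp
  have aW: "above_pow ?W" by (rule above_powI[OF pow_ideal subset_refl])
  have TP: "ideal ?TP R" by (intro ideal_prod_is_ideal T_ideal pow_ideal)
  have TPT: "?TP \<subseteq> ?T" using tc_times_ideal_pow[OF I_ideal, of 2 n] by (simp add: numeral_2_eq_2)
  have Int1: "T 2 \<inter> I = ideal_prod R I (tc I)"
    using T_Int[of 1] I_pow_1 ideal_prod_commute[OF I_ideal tc_ideal[OF I_ideal]] by (simp add: numeral_2_eq_2)
  have aInt1: "above_pow (T 2 \<inter> I)"
    using above_pow_tcI_pow[of 1] T_Int[of 1] I_pow_1 by (simp add: numeral_2_eq_2)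
  have L: "len R (set_add R (T 2) I) I = ?L"
    using len_second_iso[OF above_pow_T aI aInt1] unfolding Int1 .
  have TI: "ideal (set_add R (T 2) I) R" by (intro add_ideals T_ideal I_ideal)
  have "ideal_prod R (set_add R (T 2) I) (ideal_pow R I n) = set_add R ?TP ?W"
    using ideal_prod_distr[OF pow_ideal T_ideal I_ideal, of n 2]
      ideal_prod_commute[OF TI pow_ideal, of n] ideal_prod_commute[OF T_ideal pow_ideal, of 2 n] by simp
  then have len1: "len R (set_add R ?TP ?W) ?W = monomial_count n * ?L"
    using len_times_pow(2)[OF TI set_add_upper(2)[OF T_ideal I_ideal], of n] L by simp
  have aInt: "above_pow (?T \<inter> ?W)" unfolding T_Int by (rule above_pow_tcI_pow)
  have len2: "len R (set_add R ?T ?W) ?W = len R ?T (ideal_prod R (tc I) ?W)"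
    using len_second_iso[OF above_pow_T aW aInt] unfolding T_Int .
  have A: "ideal (set_add R ?TP ?W) R" and B: "ideal (set_add R ?T ?W) R"
    by (intro add_ideals TP pow_ideal T_ideal)+
  have WA: "?W \<subseteq> set_add R ?TP ?W" by (rule set_add_upper(2)[OF TP pow_ideal])
  have AB: "set_add R ?TP ?W \<subseteq> set_add R ?T ?W"
    using TPT by (auto simp: mem_set_add) blast
  show ?thesis
  proof
    assume "?T = ?TP"
    then show "len R ?T (ideal_prod R (tc I) ?W) = monomial_count n * ?L" using len1 len2 by simp
  next
    assume eq: "len R ?T (ideal_prod R (tc I) ?W) = monomial_count n * ?L"
    have "len R (set_add R ?T ?W) ?W
        = len R (set_add R ?T ?W) (set_add R ?TP ?W) + len R (set_add R ?TP ?W) ?W"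
      by (intro len_add aW A B WA AB)
    then have "len R (set_add R ?T ?W) (set_add R ?TP ?W) = 0" using eq len1 len2 by simp
    then have AB': "set_add R ?T ?W = set_add R ?TP ?W"
      by (intro len_eq_0 above_pow_mono[OF aW A WA] B AB)
    have "?TP \<inter> ?W = ?T \<inter> ?W"
    proof
      have "?T \<inter> ?W \<subseteq> ideal_prod R (ideal_prod R (tc I) I) (ideal_pow R I n)"
        unfolding T_Int using ideal_prod_assoc[OF tc_ideal[OF I_ideal] I_ideal pow_ideal, of n]
          ideal_prod_commute[OF I_ideal pow_ideal, of n] by simp
      also have "\<dots> \<subseteq> ?TP"
        using Int1 ideal_prod_commute[OF I_ideal tc_ideal[OF I_ideal]]
        by (intro ideal_prod_mono) auto
      finally show "?T \<inter> ?W \<subseteq> ?TP \<inter> ?W" by blast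
    qed (use TPT in blast)
    then have "?TP = ?T" by (rule modular_eq[OF TP T_ideal pow_ideal TPT _ AB'[symmetric]])
    then show "?T = ?TP" ..
  qed
qed

end

lemma card_exponents_eq: "int (card (exponents d n)) = shifted_binomial n (int d - 1)"
proof (cases d)
  case 0
  then show ?thesis by (cases n) (auto simp: card_exponents shifted_binomial_def)
next
  case (Suc k)
  have "(n + k) choose n = (n + k) choose k" using binomial_symmetric[of n "n + k"] by simp
  with Suc show ?thesis by (simp add: card_exponents shifted_binomial_def)
qed

lemma shifted_binomial_Suc:
  assumes "k \<ge> - 1"
  shows "shifted_binomial (Suc n) k = shifted_binomial n k + shifted_binomial (Suc n) (k - 1)"
proof -
  consider "k = -1" | "k = 0" | "k \<ge> 1" using assms by linarith
  then show ?thesis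
  proof cases
    case 1
    then show ?thesis by (cases n) (auto simp: shifted_binomial_def)
  next
    case 2
    then show ?thesis by (simp add: shifted_binomial_def)
  next
    case 3
    define j where "j = nat (k - 1)"
    have "nat k = Suc j" "nat (k - 1) = j" using 3 by (auto simp: j_def)
    with 3 show ?thesis by (simp add: shifted_binomial_def)
  qed
qed

lemma shifted_binomial_0: "shifted_binomial 0 k = 1"
  by (simp add: shifted_binomial_def)

lemma sum_card_exponents: "int (\<Sum>i\<le>n. card (exponents d i)) = shifted_binomial n (int d)"
proof (induction n)
  case 0
  then show ?case by (simp add: card_exponents_eq shifted_binomial_0)
next
  case (Suc n)
  then show ?case using shifted_binomial_Suc[of "int d" n] by (simp add: card_exponents_eq)
qed

lemma hilbert_sum_three:
  fixes e :: "nat \<Rightarrow> int"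
  assumes e: "\<And>i. 3 \<le> i \<Longrightarrow> e i = 0" and n: "2 \<le> n"
  shows "(\<Sum>i\<le>d. (-1) ^ i * e i * int ((Suc n + d - 1 - i) choose (d - i)))
    = e 0 * shifted_binomial n (int d) - e 1 * shifted_binomial n (int d - 1)
      + e 2 * shifted_binomial n (int d - 2)"
proof -
  let ?f = "\<lambda>i. (-1) ^ i * e i * int ((Suc n + d - 1 - i) choose (d - i))"
  obtain k where k: "n = Suc (Suc k)" using n by (metis add_2_eq_Suc le_Suc_ex)
  consider "d = 0" | "d = 1" | j where "d = Suc (Suc j)" by (metis One_nat_def not0_implies_Suc)
  then show ?thesis
  proof cases
    case 1
    then show ?thesis using k by (simp add: shifted_binomial_def)
  next
    case 2
    then show ?thesis using k by (simp add: shifted_binomial_def)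
  next
    case 3
    have "sum ?f {..d} = sum ?f {0, 1, 2}"
      using 3 e by (intro sum.mono_neutral_right) auto
    also have "\<dots> = e 0 * int ((n + d) choose d) - e 1 * int ((n + d - 1) choose (d - 1))
        + e 2 * int ((n + d - 2) choose (d - 2))" by simp
    finally have sum: "sum ?f {..d} = e 0 * int ((n + d) choose d) - e 1 * int ((n + d - 1) choose (d - 1))
        + e 2 * int ((n + d - 2) choose (d - 2))" .
    have "nat (int d - 1) = d - 1" "nat (int d - 2) = d - 2" "int d - 1 \<ge> 0" "int d - 2 \<ge> 0"
      "n + d - 1 = n + (d - 1)" "n + d - 2 = n + (d - 2)" using 3 by auto
    then have "shifted_binomial n (int d) = int ((n + d) choose d)"
      "shifted_binomial n (int d - 1) = int ((n + d - 1) choose (d - 1))"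
      "shifted_binomial n (int d - 2) = int ((n + d - 2) choose (d - 2))"
      unfolding shifted_binomial_def by simp_all
    then show ?thesis unfolding sum by simp
  qed
qed

lemma Sup_enat_mem:
  assumes "Sup S = enat d" "d \<noteq> 0"
  shows "enat d \<in> S"
proof (rule ccontr)
  assume "enat d \<notin> S"
  have "x \<le> enat (d - 1)" if "x \<in> S" for x
  proof -
    have "x \<le> enat d" "x \<noteq> enat d" using Sup_upper[OF that] assms(1) that \<open>enat d \<notin> S\<close> by auto
    then show ?thesis by (cases x) auto
  qed
  then have "Sup S \<le> enat (d - 1)" by (rule Sup_least)
  then show False using assms by simp
qed

context tight_parameters
begin

lemma multiplicity_eq: "multiplicity_ideal R (length zs) I = int (len R (carrier R) I)"
proof -
  let ?H = "\<lambda>n. len R (carrier R) (ideal_pow R I n)"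
  let ?e = "\<lambda>i. if i = 0 then int (len R (carrier R) I) else 0"
  have H: "hilbert_coeffs (length zs) ?H ?e"
    unfolding hilbert_coeffs_def
  proof (rule eventually_sequentiallyI[of 3])
    fix n :: nat assume "3 \<le> n"
    then obtain k where k: "n = Suc k" "2 \<le> k" by (cases n) auto
    have "int (len R (carrier R) (ideal_pow R I (Suc k)))
        = int (len R (carrier R) I) * shifted_binomial k (int (length zs))"
      unfolding len_pow lessThan_Suc_atMost of_nat_mult sum_card_exponents by simp
    then show "int (?H n)
        = (\<Sum>i\<le>length zs. (-1) ^ i * ?e i * int ((n + length zs - 1 - i) choose (length zs - i)))"
      unfolding k(1) by (subst hilbert_sum_three) (auto simp: k(2))
  qed
  show ?thesis
    unfolding multiplicity_ideal_def
  proof (rule the_equality)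
    show "\<exists>e. hilbert_coeffs (length zs) ?H e \<and> e 0 = int (len R (carrier R) I)"
      using H by (intro exI[of _ ?e]) simp
    fix c assume "\<exists>e. hilbert_coeffs (length zs) ?H e \<and> e 0 = c"
    then obtain e where "hilbert_coeffs (length zs) ?H e" "e 0 = c" by blast
    then show "c = int (len R (carrier R) I)"
      using hilbert_coeffs_unique[OF H, of e 0] by simp
  qed
qed

abbreviation "tc_length \<equiv> len R (tc I) I"
abbreviation "tc2_length \<equiv> len R (T 2) (ideal_prod R I (tc I))"

definition tight_formula :: "nat \<Rightarrow> bool" where
  "tight_formula n \<longleftrightarrow> int (len R (carrier R) (T (Suc n)))
     = int (len R (carrier R) I) * shifted_binomial n (int (length zs))
       - (int tc_length + int tc2_length) * shifted_binomial n (int (length zs) - 1)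
       + int tc2_length * shifted_binomial n (int (length zs) - 2)"

lemma tight_formula_iff:
  "tight_formula n \<longleftrightarrow> int (len R (T (Suc n)) (ideal_prod R (tc I) (ideal_pow R I n)))
     = int tc2_length * (shifted_binomial n (int (length zs) - 1) - shifted_binomial n (int (length zs) - 2))"
proof -
  have "int (len R (carrier R) (T (Suc n))) + int (len R (T (Suc n)) (ideal_prod R (tc I) (ideal_pow R I n)))
      + shifted_binomial n (int (length zs) - 1) * int tc_length
     = shifted_binomial n (int (length zs)) * int (len R (carrier R) I)"
    using arg_cong[OF T_length_sum[of n], of int]
    unfolding of_nat_add of_nat_mult sum_card_exponents card_exponents_eq .
  then show ?thesis unfolding tight_formula_def by (auto simp: algebra_simps)
qed

lemma tight_formula_0: "tight_formula 0"
proof -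
  have "T (Suc 0) = tc I" using I_pow_1 by simp
  then have "len R (T (Suc 0)) (ideal_prod R (tc I) (ideal_pow R I 0)) = len R (tc I) (tc I)"
    using ideal_prod_one[OF tc_ideal[OF I_ideal]] by simp
  also have "\<dots> = 0"
    using len_eq[OF tc_ideal[OF I_ideal] tc_ideal[OF I_ideal]] by (simp add: enat_0_iff zero_enat_def)
  finally show ?thesis unfolding tight_formula_iff by (simp add: shifted_binomial_0)
qed

lemma tight_formula_Suc:
  "tight_formula (Suc n) \<longleftrightarrow> T (Suc (Suc n)) = ideal_prod R (T 2) (ideal_pow R I n)"
proof -
  have "shifted_binomial (Suc n) (int (length zs) - 1)
      = int (monomial_count n) + shifted_binomial (Suc n) (int (length zs) - 2)"
    using shifted_binomial_Suc[of "int (length zs) - 1" n] by (simp add: card_exponents_eq)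
  then have "tight_formula (Suc n) \<longleftrightarrow>
      int (len R (T (Suc (Suc n))) (ideal_prod R (tc I) (ideal_pow R I (Suc n)))) = int (monomial_count n * tc2_length)"
    unfolding tight_formula_iff by (simp add: mult.commute)
  then show ?thesis unfolding T_eq_iff of_nat_eq_iff .
qed

lemma tight_formula_hilbert:
  assumes F: "\<And>n. tight_formula n"
    and e: "e 0 = int (len R (carrier R) I)" "e 1 = int tc_length + int tc2_length" "e 2 = int tc2_length"
      "\<And>i. 3 \<le> i \<Longrightarrow> e i = 0"
  shows "tight_hilbert_coeffs R p (length zs) I e"
  unfolding tight_hilbert_coeffs_def hilbert_coeffs_def
proof (rule eventually_sequentiallyI[of 3])
  fix n :: nat assume "3 \<le> n"
  then obtain k where k: "n = Suc k" "2 \<le> k" by (cases n) auto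
  show "int (len R (carrier R) (T n))
      = (\<Sum>i\<le>length zs. (-1) ^ i * e i * int ((n + length zs - 1 - i) choose (length zs - i)))"
    using F[of k] hilbert_sum_three[of e k "length zs", OF e(4) k(2)]
    unfolding k(1) e(1-3) tight_formula_def by simp
qed

end

theorem proposition4p5:
  fixes R :: "('a, 'b) ring_scheme" and m I :: "'a set" and d p :: nat
  assumes "noetherian_local_ring R m"
    and "krull_dim R = enat d"
    and "cohen_macaulay R m"
    and "analytically_unramified R m"
    and "Factorial_Ring.prime p" and "[p] \<cdot>\<^bsub>R\<^esub> \<one>\<^bsub>R\<^esub> = \<zero>\<^bsub>R\<^esub>"
    and "system_of_parameters R m xs" and "I = Idl\<^bsub>R\<^esub> (set xs)"
  shows
    "(\<forall>n\<ge>1. tight_closure R p (ideal_pow R I (n + 1))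
            = ideal_prod R (tight_closure R p (ideal_pow R I 2)) (ideal_pow R I (n - 1)))
     \<longleftrightarrow>
     (\<exists>e. tight_hilbert_coeffs R p d I e \<and>
        (\<forall>n. int (len R (carrier R) (tight_closure R p (ideal_pow R I (n + 1))))
             = e 0 * shifted_binomial n (int d)
               - e 1 * shifted_binomial n (int d - 1)
               + e 2 * shifted_binomial n (int d - 2)) \<and>
        e 0 = multiplicity_ideal R d I \<and>
        multiplicity_ideal R d I = int (len R (carrier R) I) \<and>
        e 1 = int (len R (tight_closure R p I) I)
              + int (len R (tight_closure R p (ideal_pow R I 2))
                           (ideal_prod R I (tight_closure R p I))) \<and>
        e 2 = int (len R (tight_closure R p (ideal_pow R I 2))
                         (ideal_prod R I (tight_closure R p I))) \<and>
        (\<forall>i. 3 \<le> i \<and> i \<le> d \<longrightarrow> e i = 0))"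
proof -
  have R: "cring R" "noetherian_ring R" and m: "maximalideal m R"
    using assms(1) by (auto simp: noetherian_local_ring_def)
  interpret cring R by (rule R(1))
  have mc: "m \<subseteq> carrier R" using ideal_subset maximalideal.axioms(1)[OF m] by blast
  have xs: "set xs \<subseteq> m" "d = length xs" "radical_ideal R (Idl\<^bsub>R\<^esub> (set xs)) = m"
    using assms(2,7) by (auto simp: system_of_parameters_def)
  have xc: "set xs \<subseteq> carrier R" using xs(1) mc by blast
  have rad: "\<exists>k::nat. y [^]\<^bsub>R\<^esub> k \<in> Idl\<^bsub>R\<^esub> (set xs)" if "y \<in> m" for y
    using that xs(3) unfolding radical_ideal_def by blast
  have "\<exists>ys. set ys \<subseteq> m \<and> regular_list ys \<and> length ys = d"
  proof (cases "d = 0")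
    case True
    then show ?thesis by (intro exI[of _ "[]"]) (simp add: regular_list_def)
  next
    case False
    have "enat d \<in> {enat (length ys) | ys. set ys \<subseteq> m \<and> regular_sequence R ys}"
      using assms(2,3) False by (intro Sup_enat_mem) (simp_all add: cohen_macaulay_def ring_depth_def)
    then obtain ys where "set ys \<subseteq> m" "regular_sequence R ys" "length ys = d" by auto
    then show ?thesis unfolding regular_sequence_def regular_list_def by blast
  qed
  then obtain ys where ys: "set ys \<subseteq> m" "regular_list ys" "length ys = d" by blast
  have "\<forall>y\<in>set ys. \<exists>N::nat. y [^]\<^bsub>R\<^esub> N \<in> Idl\<^bsub>R\<^esub> (set xs)"
    using rad ys(1) by (meson subsetD)
  then have zs: "param_list xs"
    unfolding param_list_def using ys xs(2) xc by (intro conjI exI[of _ ys]) auto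
  have fin: "ideal_length R (carrier R) I < \<infinity>"
  proof -
    obtain A where A: "A \<subseteq> carrier R" "finite A" "m = Idl\<^bsub>R\<^esub> A"
      using noetherian_ring.finetely_gen[OF R(2) maximalideal.axioms(1)[OF m]] by blast
    show ?thesis
    proof (rule ideal_length_finite[OF m A(2,1)])
      show "ideal I R" using Idl_ideal[OF xc] assms(8) by simp
      show "\<exists>n::nat. a [^]\<^bsub>R\<^esub> n \<in> I" if "a \<in> A" for a
        using rad genideal_self[OF A(1)] A(3) that assms(8) by blast
      show "m \<subseteq> Idl\<^bsub>R\<^esub> (A \<union> {})" using A(3) by simp
    qed simp
  qed
  interpret tight_parameters R p xs I
    using assms(5,6,8) zs fin by unfold_locales auto
  let ?F = "\<lambda>(e::nat \<Rightarrow> int) n. int (len R (carrier R) (T (n + 1)))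
             = e 0 * shifted_binomial n (int d)
               - e 1 * shifted_binomial n (int d - 1)
               + e 2 * shifted_binomial n (int d - 2)"
  have lhs: "(\<forall>n\<ge>1. T (n + 1) = ideal_prod R (T 2) (ideal_pow R I (n - 1))) \<longleftrightarrow> (\<forall>n. tight_formula n)"
  proof
    assume L: "\<forall>n\<ge>1. T (n + 1) = ideal_prod R (T 2) (ideal_pow R I (n - 1))"
    have "T (Suc (Suc n)) = ideal_prod R (T 2) (ideal_pow R I n)" for n
      using L[rule_format, of "Suc n"] by simp
    then have "tight_formula (Suc n)" for n unfolding tight_formula_Suc .
    then show "\<forall>n. tight_formula n" using tight_formula_0 by (metis not0_implies_Suc)
  next
    assume F: "\<forall>n. tight_formula n"
    show "\<forall>n\<ge>1. T (n + 1) = ideal_prod R (T 2) (ideal_pow R I (n - 1))"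
    proof (intro allI impI)
      fix n :: nat assume "1 \<le> n"
      then obtain k where k: "n = Suc k" by (cases n) auto
      have "T (Suc (Suc k)) = ideal_prod R (T 2) (ideal_pow R I k)"
        using F tight_formula_Suc by blast
      then show "T (n + 1) = ideal_prod R (T 2) (ideal_pow R I (n - 1))" using k by simp
    qed
  qed
  show ?thesis
    unfolding lhs
  proof
    assume F: "\<forall>n. tight_formula n"
    let ?e = "\<lambda>i::nat. if i = 0 then int (len R (carrier R) I) else
      if i = 1 then int tc_length + int tc2_length else if i = 2 then int tc2_length else 0"
    show "\<exists>e. tight_hilbert_coeffs R p d I e \<and> (\<forall>n. ?F e n) \<and>
        e 0 = multiplicity_ideal R d I \<and>
        multiplicity_ideal R d I = int (len R (carrier R) I) \<and>
        e 1 = int tc_length + int tc2_length \<and> e 2 = int tc2_length \<and> (\<forall>i. 3 \<le> i \<and> i \<le> d \<longrightarrow> e i = 0)"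
    proof (intro exI[of _ ?e] conjI)
      show "tight_hilbert_coeffs R p d I ?e"
        unfolding xs(2) by (rule tight_formula_hilbert) (use F in auto)
      show "\<forall>n. ?F ?e n"
        using F unfolding tight_formula_def xs(2) Suc_eq_plus1 by simp
    qed (use multiplicity_eq xs(2) in auto)
  next
    assume "\<exists>e. tight_hilbert_coeffs R p d I e \<and> (\<forall>n. ?F e n) \<and>
        e 0 = multiplicity_ideal R d I \<and>
        multiplicity_ideal R d I = int (len R (carrier R) I) \<and>
        e 1 = int tc_length + int tc2_length \<and> e 2 = int tc2_length \<and> (\<forall>i. 3 \<le> i \<and> i \<le> d \<longrightarrow> e i = 0)"
    then obtain e where e: "\<forall>n. ?F e n" "e 0 = int (len R (carrier R) I)"
      "e 1 = int tc_length + int tc2_length" "e 2 = int tc2_length" by metis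
    show "\<forall>n. tight_formula n"
      using e(1) unfolding tight_formula_def xs(2) e(2-4) Suc_eq_plus1 .
  qed
qed

end
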